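(* Let $l\ge 1$ be an odd integer. Let $2<p<q$ be primes such that $q\geq \frac{(p+l)p}{2}$ and $(l+2)q\equiv 2 \pmod p$. Let $\rho,\sigma$ be the unique non-negative integers with $1+pq=(\rho+1)p+(\sigma+1)q$. Write $\rho=\frac{(p+l)s}{2}+\tau$ with integers $s\ge 0$ and $0\le\tau<\frac{p+l}{2}$ (so $s=\lfloor 2\rho/(p+l)\rfloor$). Let $r_1,r_2>pq$ be primes such that $r_1(q-sp)\equiv -1\pmod{pq}$ and $r_2\equiv -r_1\pmod{pq}$. Put $\alpha_1^+=\frac{(p+l)q}{2}$ and $\alpha_1^-=(\rho+s)p-q$, and define $$u_1^+=(\rho-\tau)p,\quad u_1^-=-\frac{(p-l-2)q}{2}+((p-1)s+\tau)p,$$ $$u_2^+=(p-1)q-\frac{(p-l-2)sp}{2},\quad u_2^-=\frac{(p+l)q}{2}+\tau p,$$ $$t_1^{+}=\Big\lfloor\frac{(\alpha_1^+-u_1^+)r_1}{pq}\Big\rfloor+1,\quad t_1^{-}=\Big\lfloor\frac{(\alpha_1^--u_1^-)r_1}{pq}\Big\rfloor+1,$$ $$t_2^{+}=\Big\lfloor\frac{(\alpha_1^+-u_2^+)r_2}{pq}\Big\rfloor+1,\quad t_2^{-}=\Big\lfloor\frac{(\alpha_1^--u_2^-)r_2}{pq}\Big\rfloor+1,$$ and $$k_1^+=r_1u_1^++t_1^+pq,\ k_1^-=r_1u_1^-+t_1^-pq,\ k_2^+=r_2u_2^++t_2^+pq,\ k_2^-=r_2u_2^-+t_2^-pq.$$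 Let $w$ be the integer with $0\le w\le p-1$ and $w(l+2)\equiv 2\pmod p$. (i) If $l+2\le w\le \frac{p-l-2}{2}$, then $a_{pqr_1}(k_1^-)=-\frac{p-l-2}{2}$, $a_{pqr_1}(k_1^+)=\frac{p+l+2}{2}$, and $\{a_{pqr_1}(k):k\ge 0\}$ is the set of all integers in $[-\frac{p-l-2}{2},\frac{p+l+2}{2}]$. (ii) If $\frac{p+l+2}{2}\le w\le p-l-2$, then $a_{pqr_2}(k_2^-)=-\frac{p-l-2}{2}$, $a_{pqr_2}(k_2^+)=\frac{p+l+2}{2}$, and $\{a_{pqr_2}(k):k\ge 0\}$ is the set of all integers in $[-\frac{p-l-2}{2},\frac{p+l+2}{2}]$. In both cases (i) and (ii), $M(p;q)=\frac{p+l+2}{2}<\frac{2p}{3}$.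
   Context: For a positive integer $n$, the $n$-th cyclotomic polynomial is $\Phi_n(x)=\prod_{1\le j\le n,\ \gcd(j,n)=1}(x-e^{2\pi i j/n})=\sum_{k=0}^{\varphi(n)}a_n(k)x^k$, with $a_n(k)=0$ for $k>\varphi(n)$ (and for $k<0$). $A(n)=\max\{|a_n(k)|:k\ge0\}$. For primes $p<q$, $M(p;q)=\max\{A(pqr): r \text{ prime}, r>q\}$. $\lfloor x\rfloor$ denotes the largest integer $\le x$. *)

theory Defs
  imports
    Complex_Main
    "HOL-Computational_Algebra.Primes"
    "HOL-Computational_Algebra.Polynomial"
    "HOL-Number_Theory.Cong"
begin

definition cyclotomic_poly :: "nat \<Rightarrow> complex poly" where
  "cyclotomic_poly n =
     (\<Prod>j | j \<in> {1..n} \<and> coprime j n. [:- cis (2 * pi * real j / real n), 1:])"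

(* The index is an integer: the indices in the theorem are integer expressions,
   and coefficients at negative indices are 0 by convention. *)
definition cyclotomic_coeff :: "nat \<Rightarrow> int \<Rightarrow> complex" where
  "cyclotomic_coeff n k = (if k < 0 then 0 else coeff (cyclotomic_poly n) (nat k))"

definition cyclotomic_height :: "nat \<Rightarrow> real" where
  "cyclotomic_height n = Max {norm (cyclotomic_coeff n k) | k. k \<ge> 0}"

(* For primes p < q the maximum runs over a finite set of values: the coefficients are
   integers, and they are bounded by p - 1 for every r. *)
definition ternary_max_height :: "nat \<Rightarrow> nat \<Rightarrow> real" where
  "ternary_max_height p q = Max {cyclotomic_height (p * q * r) | r. prime r \<and> r > q}"

end

theory Submission
  imports Defs
begin

text \<open>
  Multiplying \<open>\<Phi>\<^bsub>pqr\<^esub>(X) \<Phi>\<^bsub>pq\<^esub>(X) = \<Phi>\<^bsub>pq\<^esub>(X\<^sup>r)\<close> by \<open>(X\<^sup>p - 1)(X\<^sup>q - 1)\<close> and using the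
  explicit form of \<open>\<Phi>\<^bsub>pq\<^esub>\<close> expresses the \<open>n\<close>-th coefficient of \<open>\<Phi>\<^bsub>pqr\<^esub>\<close> as
  \<open>\<Sum>y<p. [y \<in> J (\<xi> y)] - [y + d \<in> J (\<xi> y)]\<close>, where \<open>y + d\<close> is taken modulo \<open>p\<close>, \<open>d r \<equiv> - 1\<close>
  modulo \<open>p\<close>, \<open>\<xi>\<close> depends on \<open>n\<close>, and the cyclic intervals \<open>J x\<close> of residues modulo \<open>p\<close>, cut out by
  the threshold \<open>n div r\<close>, form a chain: \<open>J x\<close> is an initial segment of \<open>{0..\<sigma>}\<close> if \<open>x \<le> \<rho>\<close>, and the
  complement of an initial segment of \<open>{\<sigma><..<p}\<close> otherwise. The chain property gives
  \<open>\<bar>a(n) - a(n - 1)\<bar> \<le> 1\<close>. If \<open>d\<close> is small, only \<open>y \<le> \<sigma>\<close> can contribute positively and only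
  \<open>y > \<sigma>\<close> negatively, so all coefficients lie between \<open>- (p - \<sigma> - 1)\<close> and \<open>\<sigma> + 1\<close>; replacing
  \<open>d\<close> by \<open>p - d\<close> changes the sign and yields \<open>\<bar>a(n)\<bar> \<le> \<sigma> + 1\<close> for every \<open>r\<close>. For the
  given \<open>r\<close> and \<open>k\<close> the points \<open>(\<xi> y, y)\<close> lie on lines of slope determined by \<open>s\<close>, and one checks that
  every \<open>y\<close> contributes its extreme value. Here \<open>\<sigma> = (p + l) / 2\<close>.
\<close>

section \<open>Cyclotomic polynomials of products of primes\<close>

lemma pcompose_monom_monom:
  "pcompose (monom c k) (monom 1 r) = monom (c :: 'a :: comm_ring_1) (k * r)"
proof (induction k)
  case (Suc k)
  then show ?case
    by (simp add: monom_Suc pcompose_pCons mult_monom)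
qed (simp add: monom_0)

text \<open>Both sides are monic of degree \<open>r\<close>, and both vanish at the \<open>r\<close>
  distinct \<open>r\<close>-th roots of \<open>cis (r t)\<close>.\<close>

lemma prod_linear_cis:
  assumes "r > 0"
  shows "(\<Prod>i<r. [:- cis (t + 2 * pi * real i / real r), 1:]) = monom 1 r - [:cis (real r * t):]"
    (is "?P = ?Q")
proof -
  let ?f = "\<lambda>i::nat. cis (t + 2 * pi * real i / real r)"
  have f: "?f i = cis t * cis (2 * pi * real i / real r)" for i
    by (simp add: cis_mult)
  have inj: "inj_on ?f {..<r}"
    using bij_betw_roots_unity[OF assms] unfolding bij_betw_def inj_on_def f by simp
  have deg: "degree ?P = r"
    by (subst degree_prod_eq_sum_degree) auto
  have "lead_coeff ?P = 1"
    by (subst lead_coeff_prod) simp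
  show ?thesis
  proof (rule poly_eqI_degree_lead_coeff[where A = "?f ` {..<r}" and n = r])
    show "coeff ?P r = coeff ?Q r"
      using \<open>lead_coeff ?P = 1\<close> deg assms by (simp add: coeff_pCons split: nat.split)
    show "card (?f ` {..<r}) \<ge> r"
      using inj by (simp add: card_image)
    show "degree ?P \<le> r" using deg by simp
    show "degree ?Q \<le> r"
      by (intro degree_diff_le) (auto simp: degree_monom_le)
    fix z assume "z \<in> ?f ` {..<r}"
    then obtain i where i: "i < r" "z = ?f i" by auto
    have "poly ?P z = 0" using i by (auto simp: poly_prod)
    moreover have "z ^ r = cis (real r * t)"
    proof -
      have "z ^ r = cis (real r * t + 2 * pi * real i)"
        unfolding i(2) Complex.DeMoivre using assms
        by (intro arg_cong[where f = cis]) (simp add: distrib_left)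
      also have "\<dots> = cis (real r * t) * cis (2 * pi * real i)" by (rule cis_mult[symmetric])
      also have "cis (2 * pi * real i) = 1"
        using cis_multiple_2pi[of "real i"] by simp
      finally show ?thesis by simp
    qed
    ultimately show "poly ?P z = poly ?Q z" by (simp add: poly_monom)
  qed
qed

text \<open>Substituting \<open>X^r\<close> replaces each root by its \<open>r\<close>-th roots,
  whose angles \<open>(j + n i) / (n r)\<close> of a full turn exhaust the \<open>k / (n r)\<close>
  with \<open>k\<close> coprime to \<open>n\<close>. The \<open>k\<close> prime to \<open>r\<close>
  give the roots of the new polynomial, the multiples of \<open>r\<close> give those of the old one
  again.\<close>

lemma cyclotomic_poly_mult_prime:
  assumes r: "prime r" and ndvd: "\<not> r dvd n" and n: "n > 0"
  shows "cyclotomic_poly (n * r) * cyclotomic_poly n = pcompose (cyclotomic_poly n) (monom 1 r)"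
proof -
  let ?C = "{j. j \<in> {1..n} \<and> coprime j n}"
  let ?K = "{k. k \<in> {1..n * r} \<and> coprime k n}"
  let ?K1 = "{k. k \<in> {1..n * r} \<and> coprime k (n * r)}"
  define f :: "nat \<Rightarrow> complex poly"
    where "f k = [:- cis (2 * pi * real k / real (n * r)), 1:]" for k
  have r0: "r > 0" using r prime_gt_0_nat by blast
  have "pcompose (cyclotomic_poly n) (monom 1 r)
      = (\<Prod>j\<in>?C. monom 1 r - [:cis (2 * pi * real j / real n):])"
    unfolding cyclotomic_poly_def pcompose_prod
    by (intro prod.cong) (auto simp: pcompose_pCons)
  also have "\<dots> = (\<Prod>j\<in>?C. \<Prod>i<r. f (j + n * i))"
  proof (intro prod.cong refl)
    fix j
    have "monom 1 r - [:cis (2 * pi * real j / real n):]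
        = monom 1 r - [:cis (real r * (2 * pi * real j / real (n * r))):]"
      using r0 by simp
    also have "\<dots> = (\<Prod>i<r. [:- cis (2 * pi * real j / real (n * r) + 2 * pi * real i / real r), 1:])"
      by (rule prod_linear_cis[OF r0, symmetric])
    also have "\<dots> = (\<Prod>i<r. f (j + n * i))"
      unfolding f_def using n r0 by (intro prod.cong) (auto simp: field_simps)
    finally show "monom 1 r - [:cis (2 * pi * real j / real n):] = (\<Prod>i<r. f (j + n * i))" .
  qed
  also have "\<dots> = (\<Prod>(j, i)\<in>?C \<times> {..<r}. f (j + n * i))"
    by (rule prod.cartesian_product)
  also have "\<dots> = prod f ?K"
  \<comment> \<open>The residue \<open>j\<close> runs over \<open>1..n\<close> instead of
    \<open>0..n-1\<close>, hence division with remainder is applied to \<open>k - 1\<close>.\<close>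
  proof (rule prod.reindex_bij_witness
      [of _ "\<lambda>k. (Suc ((k - 1) mod n), (k - 1) div n)" "\<lambda>(j, i). j + n * i"])
    fix a assume "a \<in> ?C \<times> {..<r}"
    then obtain j i where a: "a = (j, i)" "1 \<le> j" "j \<le> n" "coprime j n" "i < r" by auto
    have dm: "(j + n * i - 1) mod n = j - 1" "(j + n * i - 1) div n = i"
      using a by (cases j; simp)+
    show "(\<lambda>k. (Suc ((k - 1) mod n), (k - 1) div n)) ((\<lambda>(j, i). j + n * i) a) = a"
      using a dm by auto
    have "n * Suc i \<le> n * r" using a by (intro mult_le_mono) auto
    then have "j + n * i \<le> n * r" using a by simp
    moreover have "coprime (j + n * i) n"
      using a by (metis coprime_iff_gcd_eq_1 gcd_add_mult gcd.commute add.commute mult.commute)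
    ultimately show "(\<lambda>(j, i). j + n * i) a \<in> ?K" using a by auto
  next
    fix k assume k: "k \<in> ?K"
    have e: "Suc ((k - 1) mod n) + n * ((k - 1) div n) = k" using k by auto
    then show "(\<lambda>(j, i). j + n * i) (Suc ((k - 1) mod n), (k - 1) div n) = k" by auto
    have "coprime (Suc ((k - 1) mod n)) n"
      using k e by (metis (no_types, lifting) coprime_iff_gcd_eq_1 gcd_add_mult gcd.commute
          add.commute mult.commute mem_Collect_eq)
    moreover have "k - 1 < r * n" using k by (auto simp: mult.commute)
    then have "(k - 1) div n < r" by (simp add: less_mult_imp_div_less)
    ultimately show "(Suc ((k - 1) mod n), (k - 1) div n) \<in> ?C \<times> {..<r}"
      using n by (auto simp: Suc_le_eq)
  qed auto
  also have "\<dots> = prod f ?K1 * prod f (?K - ?K1)"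
    by (subst prod.subset_diff[of ?K1]) (auto simp: mult.commute)
  also have "prod f (?K - ?K1) = (\<Prod>j\<in>?C. f (r * j))"
  proof (rule prod.reindex_bij_witness[of _ "\<lambda>j. r * j" "\<lambda>k. k div r"])
    fix k assume k: "k \<in> ?K - ?K1"
    then have "\<not> coprime k r" by auto
    then have dvd: "r dvd k" using r by (metis coprime_commute prime_imp_coprime)
    then show "r * (k div r) = k" by simp
    then show "f (r * (k div r)) = f k" by simp
    obtain m where m: "k = r * m" using dvd by auto
    show "k div r \<in> ?C" using k m r0 by auto
  next
    fix j assume j: "j \<in> ?C"
    show "r * j div r = j" using r0 by simp
    have "coprime r n" using r ndvd by (simp add: prime_imp_coprime)
    then show "r * j \<in> ?K - ?K1" using j r0 r not_prime_unit[of r] by auto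
  qed
  also have "(\<Prod>j\<in>?C. f (r * j)) = cyclotomic_poly n"
    unfolding cyclotomic_poly_def f_def using r0 n by (intro prod.cong) (auto simp: mult.assoc)
  also have "prod f ?K1 = cyclotomic_poly (n * r)"
    unfolding cyclotomic_poly_def f_def by simp
  finally show ?thesis by simp
qed

text \<open>The previous lemma at \<open>n = 1\<close> and at \<open>n = p\<close>; the second
  instance times \<open>X^q - 1\<close> turns the substituted polynomial into
  \<open>X^(p q) - 1\<close>. The product form serves for later cancellation.\<close>

lemma cyclotomic_poly_prime_pair:
  assumes p: "prime p" and q: "prime q" and "p \<noteq> q"
  shows "cyclotomic_poly (p * q) * ((monom 1 p - 1) * (monom 1 q - 1))
       = (monom 1 (p * q) - 1) * (monom 1 1 - 1)"
proof -
  have c1: "cyclotomic_poly 1 = monom 1 1 - 1"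
  proof -
    have "{j. j \<in> {1..1::nat} \<and> coprime j 1} = {1}" by auto
    then show ?thesis unfolding cyclotomic_poly_def by (simp add: monom_altdef one_pCons)
  qed
  have cp: "cyclotomic_poly p * cyclotomic_poly 1 = monom 1 p - 1"
    using cyclotomic_poly_mult_prime[OF p, of 1] prime_gt_1_nat[OF p] unfolding c1
    by (simp add: pcompose_diff pcompose_1 pcompose_monom_monom)
  have "cyclotomic_poly (p * q) * cyclotomic_poly p = pcompose (cyclotomic_poly p) (monom 1 q)"
    using p q \<open>p \<noteq> q\<close> by (intro cyclotomic_poly_mult_prime) (auto simp: prime_gt_0_nat dest: primes_dvd_imp_eq)
  then have "cyclotomic_poly (p * q) * ((monom 1 p - 1) * (monom 1 q - 1))
      = pcompose (cyclotomic_poly p) (monom 1 q) * pcompose (cyclotomic_poly 1) (monom 1 q)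
        * (monom 1 1 - 1)"
    unfolding cp[symmetric] c1 by (simp add: pcompose_diff pcompose_1 pcompose_monom_monom ac_simps)
  also have "pcompose (cyclotomic_poly p) (monom 1 q) * pcompose (cyclotomic_poly 1) (monom 1 q)
      = monom 1 (p * q) - 1"
    unfolding pcompose_mult[symmetric] cp by (simp add: pcompose_diff pcompose_1 pcompose_monom_monom)
  finally show ?thesis .
qed

lemma monom_geometric_sum:
  assumes "a \<le> b"
  shows "(monom 1 m - 1) * (\<Sum>i\<in>{a..<b}. monom 1 (i * m)) = monom 1 (b * m) - monom (1 :: complex) (a * m)"
  using assms
proof (induction b rule: dec_induct)
  case (step b)
  then show ?case by (simp add: distrib_left left_diff_distrib mult_monom)
qed simp

section \<open>Coefficients of ternary cyclotomic polynomials\<close>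

text \<open>With value 0 at negative indices, multiplication by a monomial is a plain shift of the
  index.\<close>

definition zcoeff :: "'a :: comm_ring_1 poly \<Rightarrow> int \<Rightarrow> 'a" where
  "zcoeff P k = (if k < 0 then 0 else coeff P (nat k))"

lemma cyclotomic_coeff_eq_zcoeff: "cyclotomic_coeff n k = zcoeff (cyclotomic_poly n) k"
  by (simp add: cyclotomic_coeff_def zcoeff_def)

lemma zcoeff_diff: "zcoeff (P - Q) k = zcoeff P k - zcoeff Q k"
  by (simp add: zcoeff_def)

lemma zcoeff_sum: "zcoeff (sum f A) k = (\<Sum>a\<in>A. zcoeff (f a) k)"
  by (simp add: zcoeff_def coeff_sum)

lemma zcoeff_monom: "zcoeff (monom c m) k = (if k = int m then c else 0)"
  by (auto simp: zcoeff_def)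

lemma zcoeff_monom_mult: "zcoeff (monom 1 m * P) k = zcoeff P (k - int m)"
  by (auto simp: zcoeff_def coeff_monom_mult nat_diff_distrib' nat_less_iff)

section \<open>Auxiliary facts on congruences and integer sequences\<close>

lemma dvd_less_imp_nonneg:
  fixes a b :: int
  assumes "b dvd a" "- b < a"
  shows "0 \<le> a"
proof -
  have "b dvd a + b" "0 < a + b" using assms by auto
  then have "b \<le> a + b" by (intro zdvd_imp_le) auto
  then show ?thesis by simp
qed

text \<open>Adding \<open>d\<close> to \<open>y\<close> adds \<open>Q d R\<close> to the left side,
  which is \<open>- Q\<close> modulo \<open>P Q\<close>; reducing \<open>y + d\<close> modulo
  \<open>P\<close> changes it by a multiple of \<open>P Q\<close>. So lowering the target by
  \<open>Q\<close> moves only the second coordinate.\<close>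

lemma cong_shift:
  fixes P Q R x y d k :: int
  assumes "[(x * P + y * Q) * R = k] (mod (P * Q))" and "[d * R = - 1] (mod P)"
  shows "[(x * P + ((y + d) mod P) * Q) * R = k - Q] (mod (P * Q))"
proof -
  obtain a where a: "(x * P + y * Q) * R - k = P * Q * a"
    using assms(1) by (auto simp: cong_iff_dvd_diff dvd_def)
  obtain b where b: "d * R + 1 = P * b"
    using assms(2) by (auto simp: cong_iff_dvd_diff dvd_def)
  define c where "c = (y + d) div P"
  have md: "(y + d) mod P = y + d - P * c"
    by (simp add: c_def minus_mult_div_eq_mod)
  have "(x * P + ((y + d) mod P) * Q) * R - (k - Q)
      = ((x * P + y * Q) * R - k) + Q * (d * R + 1) - P * Q * c * R"
    unfolding md by (simp add: algebra_simps)
  also have "\<dots> = P * Q * (a + b - c * R)"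
    unfolding a b by (simp add: algebra_simps)
  finally have "(x * P + ((y + d) mod P) * Q) * R - (k - Q) = P * Q * (a + b - c * R)" .
  then show ?thesis unfolding cong_iff_dvd_diff by (metis dvd_triv_left)
qed

lemma cong_minus_inverse_exists:
  fixes m :: int and r :: int
  assumes "coprime m r" "m > 0"
  obtains d where "0 \<le> d" "d < m" "[d * r = - 1] (mod m)"
proof -
  obtain v where v: "[r * v = 1] (mod m)"
    using cong_solve_coprime_int[of r m] assms by (auto simp: coprime_commute)
  have "[(- v) mod m * r = (- v) * r] (mod m)"
    by (intro cong_mult cong_refl) simp
  also have "[(- v) * r = - 1] (mod m)"
    using v cong_minus_minus_iff[of "r * v" 1 m] by (simp add: mult.commute)
  finally show ?thesis
    using assms by (intro that[of "(- v) mod m"]) auto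
qed

lemma int_seq_intermediate_value:
  fixes f :: "nat \<Rightarrow> int"
  assumes jump: "\<And>i. \<bar>f (Suc i) - f i\<bar> \<le> 1" and "f a \<le> z" "z \<le> f b"
  obtains i where "f i = z"
proof (cases "a \<le> b")
  case True
  then show ?thesis
    using nat_intermed_int_val[of a b f z] assms that by blast
next
  case False
  moreover have "\<bar>- f (Suc i) - - f i\<bar> \<le> 1" for i using jump[of i] by linarith
  ultimately obtain i where "- f i = - z"
    using nat_intermed_int_val[of b a "\<lambda>i. - f i" "- z"] assms by auto
  then show ?thesis using that by simp
qed

section \<open>The explicit form of \<Phi>_pq and the ternary product\<close>

locale ternary =
  fixes p q r :: nat and \<rho> \<sigma> :: int
  assumes prime_p: "prime p" and prime_q: "prime q" and prime_r: "prime r"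
    and p_gt_2: "2 < p" and p_less_q: "p < q" and q_less_r: "q < r"
    and rho_nonneg: "0 \<le> \<rho>" and sigma_nonneg: "0 \<le> \<sigma>"
    and rep: "1 + int p * int q = (\<rho> + 1) * int p + (\<sigma> + 1) * int q"
begin

lemma rho_less: "\<rho> + 1 < int q" and sigma_less: "\<sigma> + 1 < int p"
proof -
  have pq: "1 < int p" "1 < int q" using p_gt_2 p_less_q by auto
  have a: "int p \<le> (\<rho> + 1) * int p" "int q \<le> (\<sigma> + 1) * int q"
    using rho_nonneg sigma_nonneg pq by (simp_all add: mult_le_cancel_right1)
  have "(\<rho> + 1) * int p < int q * int p"
    unfolding mult.commute[of "int q" "int p"] using rep a pq by linarith
  then show "\<rho> + 1 < int q" using pq by (simp only: mult_less_cancel_right)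
  have "(\<sigma> + 1) * int q < int p * int q" using rep a pq by linarith
  then show "\<sigma> + 1 < int p" using pq by (simp only: mult_less_cancel_right)
qed

text \<open>The monomials of \<open>\<Phi>\<^bsub>pq\<^esub>\<close> are indexed by the residues \<open>x p + y q\<close> modulo \<open>p q\<close>.\<close>

definition weight :: "int \<Rightarrow> int \<Rightarrow> int" where
  "weight x y = (if x \<le> \<rho> \<and> y \<le> \<sigma> then 1 else if \<rho> < x \<and> \<sigma> < y then - 1 else 0)"

text \<open>In the negative quadrant \<open>x p + y q\<close> exceeds \<open>p q\<close> by
  \<open>rep\<close>, and subtracting \<open>p q\<close> yields the true exponent of the monomial in
  \<Phi>_pq.\<close>

definition exponent :: "int \<Rightarrow> int \<Rightarrow> int" where
  "exponent x y = x * int p + y * int q - (if \<rho> < x \<and> \<sigma> < y then int p * int q else 0)"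

definition box :: "(int \<times> int) set" where
  "box = {0..<int q} \<times> {0..<int p}"

lemma exponent_nonneg:
  assumes "0 \<le> x" "0 \<le> y"
  shows "0 \<le> exponent x y"
proof (cases "\<rho> < x \<and> \<sigma> < y")
  case True
  then have "(\<rho> + 1) * int p \<le> x * int p" "(\<sigma> + 1) * int q \<le> y * int q"
    by (simp_all add: mult_right_mono)
  then show ?thesis using True rep by (simp add: exponent_def)
next
  case False
  then show ?thesis using assms unfolding exponent_def by (subst if_not_P) auto
qed

text \<open>The right side is a product of two geometric sums minus \<open>X^(- p q)\<close> times
  another such product. Multiplied by \<open>(X^p - 1) (X^q - 1)\<close> all four sums collapse, and
  the result is compared with the product formula for \<Phi>_pq.\<close>

lemma cyclotomic_poly_pq:
  "cyclotomic_poly (p * q) = (\<Sum>(x, y)\<in>box. monom (of_int (weight x y)) (nat (exponent x y)))"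
    (is "_ = ?B")
proof -
  define a b where "a = nat \<rho>" and "b = nat \<sigma>"
  have ab: "\<rho> = int a" "\<sigma> = int b" using rho_nonneg sigma_nonneg by (auto simp: a_def b_def)
  have cmp: "int i \<le> \<rho> \<longleftrightarrow> i \<le> a" "\<rho> < int i \<longleftrightarrow> a < i"
      "int i \<le> \<sigma> \<longleftrightarrow> i \<le> b" "\<sigma> < int i \<longleftrightarrow> b < i" for i
    using ab by auto
  have "int (1 + p * q) = int (Suc a * p + Suc b * q)" using rep ab by (simp add: algebra_simps)
  then have nrep: "1 + p * q = Suc a * p + Suc b * q" by (simp only: of_nat_eq_iff)
  have aq: "Suc a < q" and bp: "Suc b < p" using rho_less sigma_less ab by auto
  let ?Z = "{0..<q} \<times> {0..<p}"
  let ?Z1 = "{0..<Suc a} \<times> {0..<Suc b}" and ?Z2 = "{Suc a..<q} \<times> {Suc b..<p}"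
  let ?F = "\<lambda>(i, j). monom (of_int (weight (int i) (int j)) :: complex) (nat (exponent (int i) (int j)))"
  let ?X = "monom (1 :: complex)"
  have "?B = sum ?F ?Z"
    by (rule sum.reindex_bij_witness
        [of _ "\<lambda>(i, j). (int i, int j)" "\<lambda>(x, y). (nat x, nat y)"]) (auto simp: box_def)
  also have "\<dots> = sum ?F (?Z1 \<union> ?Z2)"
    using aq bp by (intro sum.mono_neutral_right) (auto simp: weight_def cmp split: if_splits)
  also have "\<dots> = sum ?F ?Z1 + sum ?F ?Z2"
    by (intro sum.union_disjoint) auto
  also have "sum ?F ?Z1 = (\<Sum>i\<in>{0..<Suc a}. ?X (i * p)) * (\<Sum>j\<in>{0..<Suc b}. ?X (j * q))"
    unfolding sum_product sum.cartesian_product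
    by (intro sum.cong) (auto simp: weight_def exponent_def cmp mult_monom nat_add_distrib nat_mult_distrib)
  finally have B: "?B = (\<Sum>i\<in>{0..<Suc a}. ?X (i * p)) * (\<Sum>j\<in>{0..<Suc b}. ?X (j * q)) + sum ?F ?Z2" .
  \<comment> \<open>Multiplication by \<open>X^(p q)\<close> undoes the shift in
    \<open>exponent\<close>, so that this sum factors as well.\<close>
  have "?X (p * q) * sum ?F ?Z2 = (\<Sum>(i, j)\<in>?Z2. - (?X (i * p) * ?X (j * q)))"
    unfolding sum_distrib_left
  proof (intro sum.cong refl)
    fix z assume z: "z \<in> ?Z2"
    obtain i j where ij: "z = (i, j)" "Suc a \<le> i" "Suc b \<le> j" using z by auto
    have "int (p * q + nat (exponent (int i) (int j))) = int (i * p + j * q)"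
      using exponent_nonneg[of "int i" "int j"] ij by (simp add: exponent_def cmp)
    then have "p * q + nat (exponent (int i) (int j)) = i * p + j * q" by (simp only: of_nat_eq_iff)
    then show "?X (p * q) * ?F z = (case z of (i, j) \<Rightarrow> - (?X (i * p) * ?X (j * q)))"
      using ij by (simp add: weight_def cmp mult_monom minus_monom)
  qed
  also have "\<dots> = - ((\<Sum>i\<in>{Suc a..<q}. ?X (i * p)) * (\<Sum>j\<in>{Suc b..<p}. ?X (j * q)))"
    by (simp add: sum_product sum.cartesian_product sum_negf split_def)
  finally have B2: "?X (p * q) * sum ?F ?Z2
      = - ((\<Sum>i\<in>{Suc a..<q}. ?X (i * p)) * (\<Sum>j\<in>{Suc b..<p}. ?X (j * q)))" .
  let ?A = "?X (Suc a * p)" and ?C = "?X (Suc b * q)" and ?T = "?X (p * q)"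
  have AC: "?A * ?C = ?X 1 * ?T" using nrep by (simp add: mult_monom)
  have g: "(?X p - 1) * (\<Sum>i\<in>{0..<Suc a}. ?X (i * p)) = ?A - 1"
      "(?X q - 1) * (\<Sum>j\<in>{0..<Suc b}. ?X (j * q)) = ?C - 1"
      "(?X p - 1) * (\<Sum>i\<in>{Suc a..<q}. ?X (i * p)) = ?T - ?A"
      "(?X q - 1) * (\<Sum>j\<in>{Suc b..<p}. ?X (j * q)) = ?T - ?C"
    using monom_geometric_sum[of 0 "Suc a" p] monom_geometric_sum[of 0 "Suc b" q]
      monom_geometric_sum[of "Suc a" q p] monom_geometric_sum[of "Suc b" p q] aq bp
    by (simp_all add: mult.commute[of q p] del: sum.atLeast0_lessThan_Suc)
  have "?T * (?B * ((?X p - 1) * (?X q - 1)))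
      = ?T * (((?X p - 1) * (\<Sum>i\<in>{0..<Suc a}. ?X (i * p))) * ((?X q - 1) * (\<Sum>j\<in>{0..<Suc b}. ?X (j * q))))
        - ((?X p - 1) * (\<Sum>i\<in>{Suc a..<q}. ?X (i * p))) * ((?X q - 1) * (\<Sum>j\<in>{Suc b..<p}. ?X (j * q)))"
    unfolding B distrib_left distrib_right mult.assoc[symmetric] B2
    by (simp add: B2 algebra_simps del: sum.atLeast0_lessThan_Suc)
  also have "\<dots> = ?T * ((?A - 1) * (?C - 1)) - (?T - ?A) * (?T - ?C)"
    unfolding g ..
  \<comment> \<open>The mixed terms cancel and leave \<open>(T - 1) (A C - T)\<close>, where
    \<open>A C = X T\<close> is the representation of \<open>1 + p q\<close>.\<close>
  also have "\<dots> = ?T * ((?T - 1) * (?X 1 - 1))"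
    using AC by algebra
  finally have "?B * ((?X p - 1) * (?X q - 1)) = (?T - 1) * (?X 1 - 1)"
    by (simp add: monom_eq_0_iff)
  also have "\<dots> = cyclotomic_poly (p * q) * ((?X p - 1) * (?X q - 1))"
    using cyclotomic_poly_prime_pair[OF prime_p prime_q] p_less_q by simp
  finally have eq: "?B * ((?X p - 1) * (?X q - 1))
      = cyclotomic_poly (p * q) * ((?X p - 1) * (?X q - 1))" .
  have "?X k \<noteq> 1" if "k > 0" for k
    using that by (metis monom_eq_1_iff not_less_zero)
  then have nz: "(?X p - 1) * (?X q - 1) \<noteq> 0" using p_gt_2 p_less_q by simp
  show ?thesis by (rule mult_right_cancel[OF nz, THEN iffD1, OF eq, symmetric])
qed

text \<open>In \<open>\<Phi>_pqr \<Phi>_pq = \<Phi>_pq(X^r)\<close>, multiplication by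
  \<open>(X^p - 1) (X^q - 1)\<close> makes the second factor explicit, and the common factor
  \<open>X - 1\<close> cancels.\<close>

lemma cyclotomic_poly_pqr:
  "cyclotomic_poly (p * q * r) * (1 - monom 1 (p * q))
   = (\<Sum>m<p. monom 1 m) * (1 - monom 1 q)
     * (\<Sum>(x, y)\<in>box. monom (of_int (weight x y)) (nat (exponent x y * int r)))"
    (is "?\<Phi> * _ = _ * _ * ?R")
proof -
  let ?X = "monom (1 :: complex)"
  have pq: "p * q > 0" using p_gt_2 p_less_q by simp
  have "\<not> r dvd p * q"
    using prime_p prime_q prime_r p_less_q q_less_r
    by (auto simp: prime_dvd_mult_iff dest: primes_dvd_imp_eq)
  then have "?\<Phi> * cyclotomic_poly (p * q) = pcompose (cyclotomic_poly (p * q)) (?X r)"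
    using prime_r pq by (intro cyclotomic_poly_mult_prime) auto
  also have "\<dots> = ?R"
    unfolding cyclotomic_poly_pq pcompose_sum
    by (intro sum.cong refl)
      (auto simp: pcompose_monom_monom box_def nat_mult_distrib exponent_nonneg)
  finally have R: "?\<Phi> * cyclotomic_poly (p * q) = ?R" .
  have X1: "?X 1 - 1 \<noteq> 0" by (simp add: monom_eq_1_iff)
  have geo: "(?X 1 - 1) * (\<Sum>m<p. ?X m) = ?X p - 1"
    using monom_geometric_sum[of 0 p 1] by (simp add: atLeast0LessThan)
  have "(?X 1 - 1) * (?\<Phi> * (1 - ?X (p * q))) = - (?\<Phi> * (cyclotomic_poly (p * q) * ((?X p - 1) * (?X q - 1))))"
    using p_less_q
    by (subst cyclotomic_poly_prime_pair[OF prime_p prime_q]) (simp_all add: algebra_simps)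
  also have "\<dots> = - ((?X p - 1) * (?X q - 1) * ?R)"
    unfolding R[symmetric] by (simp add: mult_ac)
  also have "\<dots> = (?X 1 - 1) * ((\<Sum>m<p. ?X m) * (1 - ?X q) * ?R)"
    unfolding geo[symmetric] by (simp add: algebra_simps)
  finally show ?thesis by (rule mult_left_cancel[OF X1, THEN iffD1])
qed

text \<open>The \<open>k\<close>-th coefficient of \<open>\<Phi>\<^bsub>pq\<^esub>(X\<^sup>r) / (1 - X\<^bsup>pq\<^esup>)\<close>.\<close>

definition layer :: "int \<Rightarrow> int" where
  "layer k = (\<Sum>(x, y)\<in>box. if exponent x y * int r \<le> k \<and> int p * int q dvd k - exponent x y * int r
                        then weight x y else 0)"

text \<open>The coefficient of the power series
  \<open>(1 + ... + X^(p-1)) (1 - X^q) \<Phi>_pq(X^r) / (1 - X^(p q))\<close>.\<close>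

definition tcoeff :: "int \<Rightarrow> int" where
  "tcoeff n = (\<Sum>m<p. layer (n - int m) - layer (n - int m - int q))"

lemma layer_neg: "k < 0 \<Longrightarrow> layer k = 0"
  unfolding layer_def
  using exponent_nonneg by (intro sum.neutral) (force simp: box_def mult_less_0_iff not_less dest: order.strict_trans1)

text \<open>The two conditions differ only for a multiple \<open>k - e\<close> of \<open>p q\<close>
  with \<open>0 \<le> k - e < p q\<close>, that is, for \<open>e = k\<close>.\<close>

lemma layer_step:
  "of_int (layer k - layer (k - int p * int q))
   = zcoeff (\<Sum>(x, y)\<in>box. monom (of_int (weight x y) :: complex) (nat (exponent x y * int r))) k"
proof -
  let ?M = "int p * int q"
  have M: "?M > 0" using p_gt_2 p_less_q by simp
  have "layer k - layer (k - ?M)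
      = (\<Sum>(x, y)\<in>box. if k = exponent x y * int r then weight x y else 0)"
    unfolding layer_def sum_subtractf[symmetric]
  proof (intro sum.cong refl, clarify)
    fix x y
    let ?e = "exponent x y * int r"
    have d: "?M dvd k - ?M - ?e \<longleftrightarrow> ?M dvd k - ?e"
      using dvd_add_left_iff[of ?M "- ?M" "k - ?e"] by (simp add: algebra_simps)
    have "k = ?e" if "?M dvd k - ?e" "?e \<le> k" "\<not> ?e \<le> k - ?M"
      using that zdvd_imp_le[of ?M "k - ?e"] by linarith
    then show "(if ?e \<le> k \<and> ?M dvd k - ?e then weight x y else 0)
        - (if ?e \<le> k - ?M \<and> ?M dvd k - ?M - ?e then weight x y else 0)
        = (if k = ?e then weight x y else 0)"
      unfolding d using M by auto
  qed
  then show ?thesis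
    using exponent_nonneg unfolding zcoeff_sum of_int_sum
    by (auto simp: zcoeff_monom of_int_sum box_def intro!: sum.cong)
qed

text \<open>Both sides satisfy the same recursion with step \<open>p q\<close> and vanish at
  negative indices.\<close>

lemma cyclotomic_coeff_eq_tcoeff: "cyclotomic_coeff (p * q * r) n = of_int (tcoeff n)"
proof -
  let ?M = "int p * int q"
  let ?\<Phi> = "cyclotomic_poly (p * q * r)"
  define R where "R = (\<Sum>(x, y)\<in>box. monom (of_int (weight x y) :: complex) (nat (exponent x y * int r)))"
  have M: "?M > 0" using p_gt_2 p_less_q by simp
  have "?\<Phi> - monom 1 (p * q) * ?\<Phi> = ?\<Phi> * (1 - monom 1 (p * q))"
    by (simp add: right_diff_distrib mult.commute)
  also have "\<dots> = (\<Sum>m<p. monom 1 m) * (1 - monom 1 q) * R"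
    by (rule cyclotomic_poly_pqr[folded R_def])
  also have "\<dots> = (\<Sum>m<p. monom 1 m * R) - (\<Sum>m<p. monom 1 m * (monom 1 q * R))"
    by (simp add: sum_distrib_right left_diff_distrib right_diff_distrib mult.assoc)
  finally have "?\<Phi> - monom 1 (p * q) * ?\<Phi>
      = (\<Sum>m<p. monom 1 m * R) - (\<Sum>m<p. monom 1 m * (monom 1 q * R))" .
  then have "zcoeff (?\<Phi> - monom 1 (p * q) * ?\<Phi>) k
      = zcoeff ((\<Sum>m<p. monom 1 m * R) - (\<Sum>m<p. monom 1 m * (monom 1 q * R))) k" for k
    by simp
  then have "zcoeff ?\<Phi> k - zcoeff ?\<Phi> (k - ?M)
      = (\<Sum>m<p. zcoeff R (k - int m) - zcoeff R (k - int m - int q))" for k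
    unfolding zcoeff_diff zcoeff_sum[of _ "{..<p}"] zcoeff_monom_mult by (simp add: sum_subtractf)
  moreover have "zcoeff R k = of_int (layer k - layer (k - ?M))" for k
    unfolding R_def by (rule layer_step[symmetric])
  moreover have "(\<Sum>m<p. (layer (k - int m) - layer (k - int m - ?M))
        - (layer (k - int m - int q) - layer (k - int m - int q - ?M)))
      = tcoeff k - tcoeff (k - ?M)" for k
    unfolding tcoeff_def sum_subtractf[symmetric] by (intro sum.cong) (simp_all add: algebra_simps)
  ultimately have "zcoeff ?\<Phi> k - zcoeff ?\<Phi> (k - ?M) = of_int (tcoeff k - tcoeff (k - ?M))" for k
    by (metis (mono_tags, lifting) of_int_diff of_int_sum sum.cong)
  then have step: "cyclotomic_coeff (p * q * r) k = cyclotomic_coeff (p * q * r) (k - ?M)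
      + of_int (tcoeff k - tcoeff (k - ?M))" for k
    unfolding cyclotomic_coeff_eq_zcoeff by (simp add: algebra_simps)
  have neg: "cyclotomic_coeff (p * q * r) k = of_int (tcoeff k)" if "k < 0" for k
    using that by (simp add: cyclotomic_coeff_def tcoeff_def layer_neg)
  have "cyclotomic_coeff (p * q * r) (int k) = of_int (tcoeff (int k))" for k
  proof (induction k rule: less_induct)
    case (less k)
    have "cyclotomic_coeff (p * q * r) (int k - ?M) = of_int (tcoeff (int k - ?M))"
    proof (cases "int k - ?M < 0")
      case False
      then have "int k - ?M = int (nat (int k - ?M))" "nat (int k - ?M) < k" using M by linarith+
      then show ?thesis using less by metis
    qed (use neg in simp)
    then show ?case using step[of "int k"] by simp
  qed
  from this[of "nat n"] neg[of n] show ?thesis by (cases "n < 0") auto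
qed

text \<open>\<open>inside N x\<close> is the cyclic interval \<open>J x\<close>. Passing to the complement for \<open>x > \<rho>\<close> is what makes these intervals a chain.\<close>

definition inside :: "int \<Rightarrow> int \<Rightarrow> int \<Rightarrow> bool" where
  "inside N x y \<longleftrightarrow>
     (if x \<le> \<rho> then y \<le> \<sigma> \<and> x * int p + y * int q \<le> N
      else y \<le> \<sigma> \<or> x * int p + y * int q - int p * int q > N)"

lemma coprime_pq: "coprime (int p) (int q)"
  using primes_coprime[OF prime_p prime_q] p_less_q by simp

lemma coprime_r: "coprime (int p * int q) (int r)"
  using primes_coprime[OF prime_p prime_r] primes_coprime[OF prime_q prime_r] p_less_q q_less_r
  by simp

text \<open>By the Chinese remainder theorem and invertibility of \<open>r\<close>, only
  \<open>(x, y)\<close> can contribute to the sum. For \<open>x > \<rho>\<close> the term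
  \<open>of_bool (\<rho> < x)\<close> undoes the complement taken in \<open>inside\<close>.\<close>

lemma layer_eq:
  assumes x: "0 \<le> x" "x < int q" and y: "0 \<le> y" "y < int p"
    and m: "0 \<le> m" "m < int p * int q"
    and cong: "[(x * int p + y * int q) * int r = n - m] (mod (int p * int q))"
  shows "layer (n - m) = of_bool (inside (n div int r) x y) - of_bool (\<rho> < x)"
proof -
  let ?M = "int p * int q" and ?e = "exponent x y * int r"
  have r0: "int r > 0" using q_less_r by simp
  have cong_exponent: "[exponent a b = a * int p + b * int q] (mod ?M)" for a b
    by (simp add: exponent_def cong_iff_dvd_diff)
  have "[?e = n - m] (mod ?M)"
    using cong cong_trans[OF cong_mult[OF cong_exponent cong_refl]] by blast
  then have dvd: "?M dvd n - m - ?e"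
    by (simp add: cong_iff_dvd_diff dvd_diff_commute)
  have uniq: "(a, b) = (x, y)"
    if ab: "(a, b) \<in> box" and d: "?M dvd n - m - exponent a b * int r" for a b
  proof -
    have "?M dvd (exponent a b - exponent x y) * int r"
      using dvd_diff[OF dvd d] by (simp add: algebra_simps)
    then have "[exponent a b = exponent x y] (mod ?M)"
      using coprime_r by (simp add: coprime_dvd_mult_left_iff cong_iff_dvd_diff)
    then have c: "[a * int p + b * int q = x * int p + y * int q] (mod ?M)"
      using cong_exponent by (metis cong_sym cong_trans)
    then have "?M dvd (a - x) * int p + (b - y) * int q"
      by (simp add: cong_iff_dvd_diff algebra_simps)
    then have "int p dvd (a - x) * int p + (b - y) * int q" "int q dvd (a - x) * int p + (b - y) * int q"
      by (auto dest: dvd_mult_left dvd_mult_right)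
    then have "int p dvd (b - y) * int q" "int q dvd (a - x) * int p"
      by (simp_all add: dvd_add_right_iff dvd_add_left_iff)
    then have "int p dvd b - y" "int q dvd a - x"
      using coprime_pq by (simp_all add: coprime_dvd_mult_left_iff coprime_commute)
    then have "b mod int p = y mod int p" "a mod int q = x mod int q"
      by (simp_all add: mod_eq_dvd_iff)
    then show ?thesis using ab x y by (simp add: box_def)
  qed
  have "layer (n - m) = (\<Sum>z\<in>box. if z = (x, y) then if ?e \<le> n - m then weight x y else 0 else 0)"
    unfolding layer_def using uniq dvd by (intro sum.cong) (auto split: if_splits)
  also have "\<dots> = (if ?e \<le> n - m then weight x y else 0)"
    using x y by (simp add: box_def)
  also have "?e \<le> n - m \<longleftrightarrow> exponent x y \<le> n div int r"
  proof
    assume "?e \<le> n - m"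
    then have "?e \<le> n" using m by simp
    then show "exponent x y \<le> n div int r"
      using zdiv_mono1[of ?e n "int r"] r0 by simp
  next
    assume "exponent x y \<le> n div int r"
    then have "?e \<le> n div int r * int r" using r0 by simp
    also have "\<dots> \<le> n" using div_mult_mod_eq[of n "int r"] pos_mod_sign[OF r0, of n] by linarith
    \<comment> \<open>The offset \<open>m\<close> is below the modulus and the difference is a
      multiple of it, so the comparison with \<open>n - m\<close> loses nothing when made with
      \<open>n\<close>.\<close>
    finally have "- ?M < n - m - ?e" using m by simp
    from dvd_less_imp_nonneg[OF dvd this] show "?e \<le> n - m" by simp
  qed
  finally show ?thesis
    by (auto simp: weight_def exponent_def inside_def)
qed

text \<open>The offset is chosen to make the congruence hold modulo \<open>p\<close>; after division
  by \<open>p\<close>, the inverse of \<open>r\<close> modulo \<open>q\<close> gives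
  \<open>x\<close>.\<close>

lemma point_exists:
  obtains x where "0 \<le> x" "x < int q"
    "[(x * int p + y * int q) * int r = k - (k - y * int q * int r) mod int p] (mod (int p * int q))"
proof -
  have q0: "int q > 0" using p_less_q by auto
  define m where "m = (k - y * int q * int r) mod int p"
  obtain t where t: "k - m - y * int q * int r = int p * t"
  proof -
    have "int p dvd k - y * int q * int r - m" unfolding m_def by (rule dvd_minus_mod)
    then show ?thesis using that by (auto simp: dvd_def algebra_simps)
  qed
  obtain v where v: "[v * int r = - 1] (mod int q)"
    using cong_minus_inverse_exists[of "int q" "int r"] coprime_r q0 by auto
  then obtain b where b: "v * int r + 1 = int q * b"
    by (auto simp: cong_iff_dvd_diff dvd_def)
  define x where "x = (- t * v) mod int q"
  define c where "c = (- t * v) div int q"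
  have x: "x = - t * v - int q * c"
    unfolding x_def c_def by (simp add: minus_mult_div_eq_mod)
  have "(x * int p + y * int q) * int r - (k - m)
      = - int p * t * (v * int r) - int p * int q * c * int r - (k - m - y * int q * int r)"
    unfolding x by (simp add: algebra_simps)
  also have "v * int r = int q * b - 1" using b by simp
  finally have "(x * int p + y * int q) * int r - (k - m) = int p * int q * (- t * b - c * int r)"
    unfolding t by (simp add: algebra_simps)
  then have "[(x * int p + y * int q) * int r = k - m] (mod (int p * int q))"
    unfolding cong_iff_dvd_diff by (metis dvd_triv_left)
  then show ?thesis
    using q0 by (intro that[of x]) (auto simp: x_def m_def)
qed

section \<open>Shift sums and bounds for the coefficients\<close>

definition shift_sum :: "int \<Rightarrow> (int \<Rightarrow> int) \<Rightarrow> int \<Rightarrow> int" where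
  "shift_sum N \<xi> d =
     (\<Sum>y\<in>{0..<int p}. of_bool (inside N (\<xi> y) y) - of_bool (inside N (\<xi> y) ((y + d) mod int p)))"

text \<open>The congruence modulo \<open>p\<close> recovers \<open>y\<close> from
  \<open>\<mu> y\<close>, so the sum over offsets can be taken over \<open>y\<close>. The indices
  \<open>n - \<mu> y\<close> and \<open>n - \<mu> y - q\<close> share the coordinate
  \<open>\<xi> y\<close>, and the correction terms of \<open>layer_eq\<close> cancel.\<close>

lemma tcoeff_eq_shift_sum:
  assumes \<xi>: "\<And>y. 0 \<le> y \<Longrightarrow> y < int p \<Longrightarrow> 0 \<le> \<xi> y \<and> \<xi> y < int q"
    and \<mu>: "\<And>y. 0 \<le> y \<Longrightarrow> y < int p \<Longrightarrow> 0 \<le> \<mu> y \<and> \<mu> y < int p"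
    and cong: "\<And>y. 0 \<le> y \<Longrightarrow> y < int p \<Longrightarrow>
      [(\<xi> y * int p + y * int q) * int r = n - \<mu> y] (mod (int p * int q))"
    and d: "[d * int r = - 1] (mod int p)"
  shows "tcoeff n = shift_sum (n div int r) \<xi> d"
proof -
  let ?I = "{0..<int p}"
  let ?g = "\<lambda>m. layer (n - m) - layer (n - m - int q)"
  have p0: "int p > 0" using p_gt_2 by simp
  \<comment> \<open>The offsets reach \<open>p - 1 + q\<close>, which stays below the modulus
    because \<open>p \<ge> 3\<close>.\<close>
  have small: "m + int q < int p * int q" "m < int p * int q" if "m < int p" for m
  proof -
    have "3 * int q \<le> int p * int q" using p_gt_2 by (intro mult_right_mono) auto
    then show "m + int q < int p * int q" "m < int p * int q" using that p_less_q by linarith+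
  qed
  have inj: "inj_on \<mu> ?I"
  proof (rule inj_onI)
    fix y z assume y: "y \<in> ?I" and z: "z \<in> ?I" and eq: "\<mu> y = \<mu> z"
    have "int p * int q dvd (\<xi> y * int p + y * int q) * int r - (\<xi> z * int p + z * int q) * int r"
      using cong[of y] cong[of z] y z eq by (metis atLeastLessThan_iff cong_iff_dvd_diff cong_sym cong_trans)
    then have "int p dvd ((\<xi> y - \<xi> z) * int p + (y - z) * int q) * int r"
      by (auto dest!: dvd_mult_left simp: algebra_simps)
    then have "int p dvd (y - z) * int q"
      using coprime_r by (simp add: coprime_dvd_mult_left_iff dvd_add_right_iff)
    then have "int p dvd y - z"
      using coprime_pq by (simp add: coprime_dvd_mult_left_iff)
    then have "y mod int p = z mod int p" by (simp add: mod_eq_dvd_iff)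
    then show "y = z" using y z by simp
  qed
  have "\<mu> ` ?I = ?I"
    using \<mu> inj by (intro endo_inj_surj) auto
  with inj have bij: "bij_betw \<mu> ?I ?I" by (simp add: bij_betw_def)
  have "tcoeff n = sum ?g ?I"
    unfolding tcoeff_def by (rule sum.reindex_bij_witness[of _ nat int]) auto
  also have "\<dots> = (\<Sum>y\<in>?I. ?g (\<mu> y))"
    by (rule sum.reindex_bij_betw[OF bij, symmetric])
  also have "\<dots> = shift_sum (n div int r) \<xi> d"
    unfolding shift_sum_def
  proof (intro sum.cong refl)
    fix y assume "y \<in> ?I"
    then have y: "0 \<le> y" "y < int p" by auto
    have "layer (n - \<mu> y) = of_bool (inside (n div int r) (\<xi> y) y) - of_bool (\<rho> < \<xi> y)"
      using \<xi>[OF y] \<mu>[OF y] cong[OF y] y small by (intro layer_eq) auto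
    moreover have "layer (n - (\<mu> y + int q))
        = of_bool (inside (n div int r) (\<xi> y) ((y + d) mod int p)) - of_bool (\<rho> < \<xi> y)"
      using \<xi>[OF y] \<mu>[OF y] cong_shift[OF cong[OF y] d] p0 small
      by (intro layer_eq) (auto simp: diff_diff_eq)
    ultimately show "?g (\<mu> y) = of_bool (inside (n div int r) (\<xi> y) y)
        - of_bool (inside (n div int r) (\<xi> y) ((y + d) mod int p))"
      by (simp add: algebra_simps)
  qed
  finally show ?thesis .
qed

lemma tcoeff_shift_sum_exists:
  assumes "[d * int r = - 1] (mod int p)"
  obtains \<xi> where "tcoeff n = shift_sum (n div int r) \<xi> d"
proof -
  define \<mu> where "\<mu> y = (n - y * int q * int r) mod int p" for y
  have "\<exists>x. 0 \<le> x \<and> x < int q \<and>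
      [(x * int p + y * int q) * int r = n - \<mu> y] (mod (int p * int q))" for y
    unfolding \<mu>_def using point_exists[of y n] by blast
  then obtain \<xi> where "\<And>y. 0 \<le> \<xi> y \<and> \<xi> y < int q \<and>
      [(\<xi> y * int p + y * int q) * int r = n - \<mu> y] (mod (int p * int q))"
    by metis
  moreover have "0 \<le> \<mu> y \<and> \<mu> y < int p" for y using p_gt_2 by (simp add: \<mu>_def)
  ultimately show ?thesis
    using assms by (intro that[of \<xi>] tcoeff_eq_shift_sum[of \<xi> \<mu>]) blast+
qed

lemma mod_p_shift:
  assumes "0 \<le> y" "y < int p" "0 \<le> d" "d \<le> int p"
  shows "(y + d) mod int p = (if y + d < int p then y + d else y + d - int p)"
proof (cases "y + d < int p")
  case False
  then have "(y + d) mod int p = (y + d - int p) mod int p" by simp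
  also have "\<dots> = y + d - int p" using False assms by (intro mod_pos_pos_trivial) auto
  finally show ?thesis using False by simp
qed (use assms in simp)

lemma inside_mono:
  assumes "y \<le> z"
  shows "x \<le> \<rho> \<Longrightarrow> inside N x z \<Longrightarrow> inside N x y"
    and "\<rho> < x \<Longrightarrow> \<sigma> < y \<Longrightarrow> inside N x y \<Longrightarrow> inside N x z"
proof -
  have "y * int q \<le> z * int q" using assms by (simp add: mult_right_mono)
  then show "x \<le> \<rho> \<Longrightarrow> inside N x z \<Longrightarrow> inside N x y"
    and "\<rho> < x \<Longrightarrow> \<sigma> < y \<Longrightarrow> inside N x y \<Longrightarrow> inside N x z"
    using assms by (auto simp: inside_def)
qed

text \<open>For \<open>y > \<sigma>\<close> the interval contains everything from \<open>y\<close>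
  up to \<open>p - 1\<close> and then \<open>0..\<sigma>\<close>; a shift by at most
  \<open>\<sigma> + 1\<close> cannot leave this stretch.\<close>

lemma inside_gain_imp_le:
  assumes "0 \<le> y" "y < int p" "0 \<le> d" "d \<le> \<sigma> + 1"
    and "inside N x y" "\<not> inside N x ((y + d) mod int p)"
  shows "y \<le> \<sigma>"
proof (rule ccontr)
  assume y: "\<not> y \<le> \<sigma>"
  then have x: "\<rho> < x" using assms(5) by (auto simp: inside_def split: if_splits)
  show False
  proof (cases "y + d < int p")
    case True
    then show False
      using assms x y inside_mono(2)[of y "y + d" x N] by simp
  next
    case False
    then have "(y + d) mod int p \<le> \<sigma>"
      using assms sigma_less by (subst mod_p_shift) auto
    then show False using assms x by (simp add: inside_def)
  qed
qed

text \<open>For \<open>y \<le> \<sigma>\<close> the interval is an initial segment ending before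
  \<open>y\<close>, and the shift is too short to wrap around to it.\<close>

lemma inside_loss_imp_gt:
  assumes "0 \<le> y" "y < int p" "0 \<le> d" "d \<le> int p - \<sigma> - 1"
    and "\<not> inside N x y" "inside N x ((y + d) mod int p)"
  shows "\<sigma> < y"
proof (rule ccontr)
  assume y: "\<not> \<sigma> < y"
  then have x: "x \<le> \<rho>" using assms(5) by (auto simp: inside_def split: if_splits)
  have "(y + d) mod int p = y + d" using assms y by simp
  then show False using assms x inside_mono(1)[of y "y + d" x N] by simp
qed

lemma sum_of_bool_le_sigma: "(\<Sum>y\<in>{0..<int p}. of_bool (y \<le> \<sigma>)) = \<sigma> + 1"
proof -
  have "{0..<int p} \<inter> {y. y \<le> \<sigma>} = {0..\<sigma>}" using sigma_less by auto
  then show ?thesis using sigma_nonneg by simp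
qed

lemma sum_of_bool_gt_sigma: "(\<Sum>y\<in>{0..<int p}. of_bool (\<sigma> < y)) = int p - \<sigma> - 1"
proof -
  have "{0..<int p} \<inter> {y. \<sigma> < y} = {\<sigma><..<int p}" using sigma_nonneg by auto
  then show ?thesis using sigma_less by simp
qed

lemma shift_sum_le:
  assumes "0 \<le> d" "d \<le> \<sigma> + 1"
  shows "shift_sum N \<xi> d \<le> \<sigma> + 1"
proof -
  have "shift_sum N \<xi> d \<le> (\<Sum>y\<in>{0..<int p}. of_bool (y \<le> \<sigma>))"
    unfolding shift_sum_def
    by (rule sum_mono) (use inside_gain_imp_le assms in auto)
  then show ?thesis using sum_of_bool_le_sigma by simp
qed

lemma shift_sum_ge:
  assumes "0 \<le> d" "d \<le> int p - \<sigma> - 1"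
  shows "- (int p - \<sigma> - 1) \<le> shift_sum N \<xi> d"
proof -
  have "(\<Sum>y\<in>{0..<int p}. - of_bool (\<sigma> < y)) \<le> shift_sum N \<xi> d"
    unfolding shift_sum_def
    by (rule sum_mono) (use inside_loss_imp_gt assms in auto)
  then show ?thesis using sum_of_bool_gt_sigma by (simp add: sum_negf)
qed

text \<open>Summing over the shifted point instead of \<open>y\<close> exchanges the two terms of
  each difference.\<close>

lemma shift_sum_reflect:
  "shift_sum N \<xi> d = - shift_sum N (\<lambda>z. \<xi> ((z - d) mod int p)) (int p - d)"
proof -
  have p0: "int p > 0" using p_gt_2 by simp
  have m1: "((y + d) mod int p - d) mod int p = y" if "0 \<le> y" "y < int p" for y
    using that by (simp add: mod_diff_left_eq)
  have m2: "((z - d) mod int p + d) mod int p = z" if "0 \<le> z" "z < int p" for z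
    using that by (simp add: mod_add_left_eq)
  have m3: "(z + (int p - d)) mod int p = (z - d) mod int p" for z
    using mod_add_self1[of "int p" "z - d"] by (simp add: algebra_simps)
  have "shift_sum N \<xi> d = (\<Sum>z\<in>{0..<int p}. of_bool (inside N (\<xi> ((z - d) mod int p)) ((z - d) mod int p))
      - of_bool (inside N (\<xi> ((z - d) mod int p)) z))"
    unfolding shift_sum_def
    by (rule sum.reindex_bij_witness[of _ "\<lambda>z. (z - d) mod int p" "\<lambda>y. (y + d) mod int p"])
      (use p0 m1 m2 in auto)
  also have "\<dots> = - shift_sum N (\<lambda>z. \<xi> ((z - d) mod int p)) (int p - d)"
    unfolding shift_sum_def m3 by (simp add: sum_subtractf)
  finally show ?thesis .
qed

lemma tcoeff_range:
  assumes "0 \<le> d" "d \<le> \<sigma> + 1" "d \<le> int p - \<sigma> - 1" "[d * int r = - 1] (mod int p)"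
  shows "- (int p - \<sigma> - 1) \<le> tcoeff n" "tcoeff n \<le> \<sigma> + 1"
proof -
  obtain \<xi> where "tcoeff n = shift_sum (n div int r) \<xi> d"
    using tcoeff_shift_sum_exists assms(4) by blast
  then show "- (int p - \<sigma> - 1) \<le> tcoeff n" "tcoeff n \<le> \<sigma> + 1"
    using shift_sum_le shift_sum_ge assms by simp_all
qed

text \<open>For each of the two bounds, either \<open>d\<close> or its reflection
  \<open>p - d\<close> is small enough; the hypothesis says that \<open>p - \<sigma> - 1\<close>,
  the other extreme, is no larger than \<open>\<sigma> + 1\<close>.\<close>

lemma abs_tcoeff_le:
  assumes "int p \<le> 2 * (\<sigma> + 1)"
  shows "\<bar>tcoeff n\<bar> \<le> \<sigma> + 1"
proof -
  obtain d where d: "0 \<le> d" "d < int p" "[d * int r = - 1] (mod int p)"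
    using cong_minus_inverse_exists[of "int p" "int r"] coprime_r p_gt_2 by auto
  obtain \<xi> where t: "tcoeff n = shift_sum (n div int r) \<xi> d"
    using tcoeff_shift_sum_exists d(3) by blast
  define \<eta> where "\<eta> = (\<lambda>z. \<xi> ((z - d) mod int p))"
  have t': "tcoeff n = - shift_sum (n div int r) \<eta> (int p - d)"
    unfolding t \<eta>_def by (rule shift_sum_reflect)
  have "tcoeff n \<le> \<sigma> + 1"
  proof (cases "d \<le> \<sigma> + 1")
    case True
    then show ?thesis using t shift_sum_le d by simp
  next
    case False
    then show ?thesis using t' shift_sum_ge[of "int p - d" "n div int r" \<eta>] d assms by simp
  qed
  moreover have "- (\<sigma> + 1) \<le> tcoeff n"
  proof (cases "d \<le> int p - \<sigma> - 1")
    case True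
    then show ?thesis using t shift_sum_ge[of d "n div int r" \<xi>] d assms by simp
  next
    case False
    then show ?thesis using t' shift_sum_le[of "int p - d" "n div int r" \<eta>] d by simp
  qed
  ultimately show ?thesis by simp
qed

text \<open>On each side of \<open>\<rho>\<close> the intervals are cut out by a threshold moving
  with \<open>x\<close>; those for \<open>x \<le> \<rho>\<close> lie in
  \<open>{0..\<sigma>}\<close>, which the others contain.\<close>

lemma inside_chain:
  assumes "inside N x y" "\<not> inside N x y'" "inside N x' y'"
  shows "inside N x' y"
  using assms unfolding inside_def by (cases "x \<le> \<rho>"; cases "x' \<le> \<rho>"; simp; linarith)

text \<open>The sum over \<open>m\<close> telescopes to four layers, at the corners of the rectangle
  with sides \<open>x, x + e\<close> and \<open>y, y + d\<close>. The alternating sum is 2 or -2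
  only if two intervals are incomparable.\<close>

lemma tcoeff_jump: "\<bar>tcoeff n - tcoeff (n - 1)\<bar> \<le> 1"
proof -
  define g where "g m = layer (n - int m) - layer (n - int m - int q)" for m
  have "tcoeff n - tcoeff (n - 1) = (\<Sum>m<p. g m - g (Suc m))"
    unfolding tcoeff_def g_def sum_subtractf[symmetric]
    by (intro sum.cong) (auto simp: algebra_simps)
  also have "\<dots> = g 0 - g p" by (rule sum_lessThan_telescope')
  finally have jump: "tcoeff n - tcoeff (n - 1)
      = layer (n - 0) - layer (n - int q) - layer (n - int p) + layer (n - (int p + int q))"
    by (simp add: g_def algebra_simps)
  obtain d where d: "[d * int r = - 1] (mod int p)"
    using cong_minus_inverse_exists[of "int p" "int r"] coprime_r p_gt_2 by auto
  obtain e where e: "[e * int r = - 1] (mod int q)"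
    using cong_minus_inverse_exists[of "int q" "int r"] coprime_r p_gt_2 p_less_q by auto
  have pq: "int p > 0" "int q > 0" using p_gt_2 p_less_q by auto
  have "3 * int q \<le> int p * int q" using p_gt_2 by (intro mult_right_mono) auto
  then have small: "int p + int q < int p * int q" "int p < int p * int q"
      "int q < int p * int q" "0 < int p * int q"
    using p_less_q pq by linarith+
  have "coprime (int p) (int q * int r)" using coprime_pq coprime_r by simp
  then obtain v where v: "[v * (int q * int r) = - 1] (mod int p)"
    using cong_minus_inverse_exists pq by blast
  \<comment> \<open>This \<open>y\<close> makes the offset of \<open>point_exists\<close> zero, so
    the first corner represents \<open>n\<close> itself.\<close>
  define y where "y = (- n * v) mod int p"
  have y: "0 \<le> y" "y < int p" using pq by (simp_all add: y_def)
  have "[y * (int q * int r) = - n * v * (int q * int r)] (mod int p)"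
    unfolding y_def by (intro cong_mult cong_refl) simp
  also have "[- n * v * (int q * int r) = n] (mod int p)"
    using cong_mult[OF cong_refl[of "- n"] v] by (simp add: mult.assoc)
  finally have "(n - y * int q * int r) mod int p = 0"
    by (simp add: cong_iff_dvd_diff dvd_diff_commute mult.assoc mod_eq_0_iff_dvd)
  then obtain x where x: "0 \<le> x" "x < int q"
    and c0: "[(x * int p + y * int q) * int r = n - 0] (mod (int p * int q))"
    using point_exists[of y n] by metis
  let ?x = "(x + e) mod int q" and ?y = "(y + d) mod int p"
  have c1: "[(x * int p + ?y * int q) * int r = n - int q] (mod (int p * int q))"
    using cong_shift[OF c0 d] by simp
  have "[(y * int q + x * int p) * int r = n] (mod (int q * int p))"
    using c0 by (simp add: add.commute mult.commute[of "int q" "int p"])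
  from cong_shift[OF this e]
  have c2: "[(?x * int p + y * int q) * int r = n - int p] (mod (int p * int q))"
    by (simp add: add.commute mult.commute[of "int q" "int p"])
  have c3: "[(?x * int p + ?y * int q) * int r = n - (int p + int q)] (mod (int p * int q))"
    using cong_shift[OF c2 d] by (simp add: diff_diff_eq)
  have xy: "0 \<le> ?x" "?x < int q" "0 \<le> ?y" "?y < int p" using pq by auto
  let ?i = "inside (n div int r)"
  have "tcoeff n - tcoeff (n - 1)
      = of_bool (?i x y) - of_bool (?i x ?y) - of_bool (?i ?x y) + of_bool (?i ?x ?y)"
    unfolding jump
    using layer_eq[OF x y _ _ c0] layer_eq[OF x xy(3,4) _ _ c1] layer_eq[OF xy(1,2) y _ _ c2]
      layer_eq[OF xy _ _ c3] small by simp
  then show ?thesis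
    using inside_chain[of "n div int r" x y ?y ?x] inside_chain[of "n div int r" x ?y y ?x]
    by (auto simp: of_bool_def split: if_splits)
qed

section \<open>From bounds to coefficient sets and heights\<close>

lemma tcoeff_neg: "n < 0 \<Longrightarrow> tcoeff n = 0"
  by (simp add: tcoeff_def layer_neg)

text \<open>Jumps of at most 1 fill the range between the two extremes; the signs of
  \<open>a\<close> and \<open>b\<close> place both indices in the nonnegative range.\<close>

lemma coeff_set_eq_interval:
  assumes "\<And>n. a \<le> tcoeff n" "\<And>n. tcoeff n \<le> b"
    and km: "tcoeff km = a" "a < 0" and kp: "tcoeff kp = b" "0 < b"
  shows "{cyclotomic_coeff (p * q * r) k | k. k \<ge> 0} = {of_int z | z. a \<le> z \<and> z \<le> b}"
proof -
  have nn: "0 \<le> km" "0 \<le> kp"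
    using km kp tcoeff_neg[of km] tcoeff_neg[of kp] by (simp_all add: not_less[symmetric]) auto
  have "\<exists>k\<ge>0. tcoeff k = z" if z: "a \<le> z" "z \<le> b" for z
  proof -
    have "\<bar>tcoeff (int (Suc i)) - tcoeff (int i)\<bar> \<le> 1" for i
      using tcoeff_jump[of "int (Suc i)"] by simp
    then obtain i where "tcoeff (int i) = z"
      using int_seq_intermediate_value[of "\<lambda>i. tcoeff (int i)" "nat km" z "nat kp"] nn km kp z
      by auto
    then show ?thesis by (intro exI[of _ "int i"]) simp
  qed
  then show ?thesis
    unfolding cyclotomic_coeff_eq_tcoeff using assms by fastforce
qed

text \<open>Membership in a finite set of integers, independent of \<open>r\<close>, later makes the
  set of heights finite, as \<open>Max\<close> requires.\<close>

lemma cyclotomic_height_le: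
  assumes "\<And>n. \<bar>tcoeff n\<bar> \<le> b"
  shows "cyclotomic_height (p * q * r) \<in> real_of_int ` {0..b}"
    and "tcoeff k = b \<Longrightarrow> 0 < b \<Longrightarrow> cyclotomic_height (p * q * r) = of_int b"
proof -
  let ?S = "{norm (cyclotomic_coeff (p * q * r) k) | k. k \<ge> 0}"
  have n: "norm (cyclotomic_coeff (p * q * r) k) = real_of_int \<bar>tcoeff k\<bar>" for k
    by (simp add: cyclotomic_coeff_eq_tcoeff)
  have S: "?S \<subseteq> real_of_int ` {0..b}"
  proof
    fix v assume "v \<in> ?S"
    then obtain k where "v = real_of_int \<bar>tcoeff k\<bar>" using n by auto
    then show "v \<in> real_of_int ` {0..b}"
      using assms[of k] by (intro image_eqI[of _ _ "\<bar>tcoeff k\<bar>"]) auto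
  qed
  then have fin: "finite ?S" by (rule finite_subset) simp
  moreover have "?S \<noteq> {}" by (auto intro: exI[of _ 0])
  ultimately have "Max ?S \<in> ?S" by (rule Max_in)
  then show "cyclotomic_height (p * q * r) \<in> real_of_int ` {0..b}"
    using S unfolding cyclotomic_height_def by blast
  assume k: "tcoeff k = b" "0 < b"
  then have "0 \<le> k" using tcoeff_neg[of k] by force
  then have "real_of_int b \<in> ?S" using k n[of k] by force
  then show "cyclotomic_height (p * q * r) = of_int b"
    unfolding cyclotomic_height_def using fin S by (intro Max_eqI) auto
qed

end

section \<open>The extremal family\<close>

text \<open>With \<open>\<sigma> = (p + l) / 2\<close> the bounds on \<open>d\<close> read
  \<open>l + 2 \<le> d \<le> (p - l - 2) / 2\<close>, the range of case (i). The shift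
  \<open>d\<close> will be \<open>w\<close> for the first prime and \<open>p - w\<close> for the
  second.\<close>

locale ternary_family = ternary +
  fixes s \<tau> d :: int
  assumes rho_eq: "\<rho> = \<sigma> * s + \<tau>" and tau_nonneg: "0 \<le> \<tau>" and tau_less: "\<tau> < \<sigma>"
    and s_nonneg: "0 \<le> s" and q_ge: "\<sigma> * int p \<le> int q"
    and p_le: "int p \<le> 2 * \<sigma> + 1"
    and d_ge: "2 * \<sigma> + 2 - int p \<le> d" and d_le: "d \<le> int p - \<sigma> - 1"
    and d_cong: "[d * int r = - 1] (mod int p)"
    and pq_less_r: "p * q < r"
begin

section \<open>The slope s and the gap q - s p\<close>

lemma d_pos: "0 < d"
  using d_ge p_le by simp

lemma rho_p: "\<rho> * int p = 1 + (int p - \<sigma> - 1) * int q - int p"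
  using rep by (simp add: algebra_simps)

lemma sigma_s_p: "\<sigma> * (s * int p) = 1 + (int p - \<sigma> - 1) * int q - int p - \<tau> * int p"
  using rho_p unfolding rho_eq by (simp add: algebra_simps)

lemma s_p_less: "s * int p < int q"
proof -
  have "0 \<le> \<tau> * int p" using tau_nonneg by simp
  moreover have "(int p - \<sigma> - 1) * int q \<le> \<sigma> * int q"
    using p_le by (intro mult_right_mono) auto
  ultimately have "\<sigma> * (s * int p) < \<sigma> * int q" using sigma_s_p p_gt_2 by linarith
  then show ?thesis using sigma_nonneg by (simp add: mult_less_cancel_left)
qed

lemma s_pos: "0 < s"
proof (rule ccontr)
  assume "\<not> 0 < s"
  then have "\<rho> < \<sigma>" using s_nonneg rho_eq tau_less by simp
  then have "\<rho> * int p \<le> (\<sigma> - 1) * int p" by (intro mult_right_mono) auto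
  moreover have "1 * int q \<le> (int p - \<sigma> - 1) * int q"
    using d_pos d_le by (intro mult_right_mono) auto
  ultimately show False using rho_p q_ge by (simp add: left_diff_distrib)
qed

text \<open>The worst case \<open>j = \<sigma>\<close> equals
  \<open>(2 \<sigma> + 1 - p) q + (\<tau> + 1) p - 1\<close>, and
  \<open>(\<tau> + 1) p \<le> \<sigma> p \<le> q\<close>. A point lying \<open>j\<close> gaps below
  the threshold is thus carried past it by the shift \<open>d\<close>.\<close>

lemma mult_gap_less:
  assumes "0 \<le> j" "j \<le> \<sigma>"
  shows "j * int q - j * (s * int p) < d * int q"
proof -
  have "j * (int q - s * int p) \<le> \<sigma> * (int q - s * int p)"
    using assms s_p_less by (intro mult_right_mono) auto
  also have "\<dots> = (2 * \<sigma> + 1 - int p) * int q + (\<tau> + 1) * int p - 1"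
    using sigma_s_p by (simp add: algebra_simps)
  also have "(\<tau> + 1) * int p \<le> \<sigma> * int p" using tau_less by (intro mult_right_mono) auto
  also have "(2 * \<sigma> + 1 - int p) * int q + \<sigma> * int p - 1 < (2 * \<sigma> + 2 - int p) * int q"
    using q_ge by (simp add: algebra_simps)
  also have "\<dots> \<le> d * int q" using d_ge by (intro mult_right_mono) auto
  finally show ?thesis by (simp add: right_diff_distrib)
qed

lemma mult_gap_nonneg: "0 \<le> j \<Longrightarrow> j * (s * int p) \<le> j * int q"
  using s_p_less by (intro mult_left_mono) auto

lemma mult_gap_pos: "0 < j \<Longrightarrow> j * (s * int p) < j * int q"
  using s_p_less by simp

text \<open>The choice of \<open>t\<close> gives the least number above \<open>\<alpha> r\<close>
  congruent to \<open>r u\<close> modulo \<open>p q\<close>; the excess is at most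
  \<open>p q < r\<close>.\<close>

lemma div_eq_threshold:
  assumes t: "t = \<lfloor>real_of_int ((\<alpha> - u) * int r) / (real p * real q)\<rfloor> + 1"
  shows "(int r * u + t * int p * int q) div int r = \<alpha>"
proof -
  let ?M = "int p * int q" and ?a = "(\<alpha> - u) * int r"
  have M: "0 < ?M" "?M < int r"
    using p_gt_2 p_less_q pq_less_r of_nat_less_iff[of "p * q" r, where ?'a = int] by simp_all
  have "t = ?a div ?M + 1"
    unfolding t using floor_divide_of_int_eq[of ?a ?M, where ?'a = real] by simp
  then have "int r * u + t * int p * int q = int r * u + (?a div ?M) * ?M + ?M"
    by (simp add: algebra_simps)
  also have "(?a div ?M) * ?M = ?a - ?a mod ?M" by (simp add: minus_mod_eq_div_mult)
  finally have n: "int r * u + t * int p * int q = \<alpha> * int r + (?M - ?a mod ?M)"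
    by (simp add: algebra_simps)
  have "0 \<le> ?a mod ?M" "?a mod ?M < ?M" using M by simp_all
  then have "0 \<le> ?M - ?a mod ?M" "?M - ?a mod ?M < int r" using M by linarith+
  then show ?thesis unfolding n by simp
qed

text \<open>Since \<open>g\<close> is the negative inverse of \<open>r\<close>, lowering the index
  by \<open>\<mu>\<close> corresponds to adding \<open>\<mu> g\<close> to the residue
  \<open>u\<close>.\<close>

lemma tcoeff_eq_threshold_shift_sum:
  assumes g: "[int r * g = - 1] (mod (int p * int q))"
    and t: "t = \<lfloor>real_of_int ((\<alpha> - u) * int r) / (real p * real q)\<rfloor> + 1"
    and \<xi>: "\<And>y. 0 \<le> y \<Longrightarrow> y < int p \<Longrightarrow> 0 \<le> \<xi> y \<and> \<xi> y < int q"
    and \<mu>: "\<And>y. 0 \<le> y \<Longrightarrow> y < int p \<Longrightarrow> 0 \<le> \<mu> y \<and> \<mu> y < int p"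
    and point: "\<And>y. 0 \<le> y \<Longrightarrow> y < int p \<Longrightarrow>
      [\<xi> y * int p + y * int q = u + \<mu> y * g] (mod (int p * int q))"
  shows "tcoeff (int r * u + t * int p * int q) = shift_sum \<alpha> \<xi> d"
proof -
  let ?n = "int r * u + t * int p * int q"
  have "[(\<xi> y * int p + y * int q) * int r = ?n - \<mu> y] (mod (int p * int q))"
    if y: "0 \<le> y" "y < int p" for y
  proof -
    have "[(\<xi> y * int p + y * int q) * int r = (u + \<mu> y * g) * int r] (mod (int p * int q))"
      by (intro cong_mult point y cong_refl)
    also have "(u + \<mu> y * g) * int r = int r * u + \<mu> y * (int r * g)"
      by (simp add: algebra_simps)
    also have "[int r * u + \<mu> y * (int r * g) = int r * u + \<mu> y * (- 1)] (mod (int p * int q))"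
      by (intro cong_add cong_mult g cong_refl)
    also have "[int r * u + \<mu> y * (- 1) = ?n - \<mu> y] (mod (int p * int q))"
      by (simp add: cong_iff_dvd_diff mult.assoc)
    finally show ?thesis .
  qed
  then have "tcoeff ?n = shift_sum (?n div int r) \<xi> d"
    using \<xi> \<mu> d_cong by (intro tcoeff_eq_shift_sum[where \<mu> = \<mu>]) auto
  then show ?thesis using div_eq_threshold[OF t] by simp
qed

text \<open>The points \<open>(\<xi> y, y)\<close> of the coefficients \<open>k\<^sup>+\<close> and \<open>k\<^sup>-\<close>; they are the same for \<open>r\<^sub>1\<close> and \<open>r\<^sub>2\<close>.\<close>

definition xi_max :: "int \<Rightarrow> int" where
  "xi_max y = (if y \<le> \<sigma> then (\<sigma> - y) * s else int q - (y - \<sigma>) * s)"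

definition xi_min :: "int \<Rightarrow> int" where
  "xi_min y = (if y \<le> \<sigma> then (\<sigma> - y) * s + \<tau> else (int p + \<sigma> - y) * s + \<tau>)"

lemma xi_max_le:
  assumes "0 \<le> y" "y \<le> \<sigma>"
  shows "0 \<le> xi_max y" "xi_max y \<le> \<rho>"
proof -
  have "(\<sigma> - y) * s \<le> \<sigma> * s" using assms s_nonneg by (intro mult_right_mono) auto
  then show "0 \<le> xi_max y" "xi_max y \<le> \<rho>"
    using assms s_nonneg rho_eq tau_nonneg by (auto simp: xi_max_def)
qed

text \<open>As \<open>s p < q\<close>, the left side of \<open>rep\<close> bounds the drop along the
  line: \<open>p\<close> times the coordinate is at least \<open>(\<sigma> + 1) q\<close>, which
  exceeds \<open>\<rho> p\<close>.\<close>

lemma xi_max_gt: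
  assumes "\<sigma> < y" "y < int p"
  shows "\<rho> < xi_max y" "xi_max y < int q"
proof -
  show "xi_max y < int q" using assms s_pos by (simp add: xi_max_def)
  have "(y - \<sigma>) * (s * int p) \<le> (y - \<sigma>) * int q" using assms mult_gap_nonneg by simp
  also have "\<dots> \<le> (int p - 1 - \<sigma>) * int q" using assms by (intro mult_right_mono) auto
  finally have "(\<sigma> + 1) * int q \<le> (int q - (y - \<sigma>) * s) * int p" by (simp add: algebra_simps)
  moreover have "(int p - \<sigma> - 1) * int q \<le> (\<sigma> + 1) * int q"
    using p_le by (intro mult_right_mono) auto
  ultimately have "\<rho> * int p < (int q - (y - \<sigma>) * s) * int p" using rho_p p_gt_2 by linarith
  then show "\<rho> < xi_max y" using assms by (simp add: xi_max_def mult_less_cancel_right)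
qed

lemma xi_max_range:
  assumes "0 \<le> y" "y < int p"
  shows "0 \<le> xi_max y \<and> xi_max y < int q"
  using xi_max_le[of y] xi_max_gt[of y] assms rho_less rho_nonneg by (cases "y \<le> \<sigma>") auto

text \<open>For \<open>y \<le> \<sigma>\<close> the point is \<open>\<sigma> - y\<close> gaps below
  the threshold and the shift overshoots it. For \<open>y > \<sigma>\<close> the reduced value is
  \<open>y - \<sigma>\<close> gaps above, and \<open>inside_gain_imp_le\<close> forbids leaving the
  interval.\<close>

lemma shift_sum_max: "shift_sum (\<sigma> * int q) xi_max d = \<sigma> + 1"
proof -
  have "of_bool (inside (\<sigma> * int q) (xi_max y) y)
      - of_bool (inside (\<sigma> * int q) (xi_max y) ((y + d) mod int p)) = (of_bool (y \<le> \<sigma>) :: int)"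
    if y: "0 \<le> y" "y < int p" for y
  proof (cases "y \<le> \<sigma>")
    case True
    have "inside (\<sigma> * int q) (xi_max y) y"
      using True xi_max_le[OF y(1) True] mult_gap_nonneg[of "\<sigma> - y"]
      by (simp add: inside_def xi_max_def algebra_simps)
    moreover have "\<not> inside (\<sigma> * int q) (xi_max y) (y + d)"
      using True xi_max_le[OF y(1) True] mult_gap_less[of "\<sigma> - y"] y
      by (simp add: inside_def xi_max_def algebra_simps)
    moreover have "(y + d) mod int p = y + d" using True y d_pos d_le by simp
    ultimately show ?thesis using True by simp
  next
    case False
    then have "inside (\<sigma> * int q) (xi_max y) y"
      using xi_max_gt[of y] mult_gap_pos[of "y - \<sigma>"] y
      by (simp add: inside_def xi_max_def algebra_simps)
    then have "inside (\<sigma> * int q) (xi_max y) ((y + d) mod int p)"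
      using inside_gain_imp_le[OF y, of d] False d_pos d_le p_le by fastforce
    with \<open>inside (\<sigma> * int q) (xi_max y) y\<close> show ?thesis using False by simp
  qed
  then have "shift_sum (\<sigma> * int q) xi_max d = (\<Sum>y\<in>{0..<int p}. of_bool (y \<le> \<sigma>))"
    unfolding shift_sum_def by (intro sum.cong) auto
  then show ?thesis using sum_of_bool_le_sigma by simp
qed

lemma xi_min_le:
  assumes "0 \<le> y" "y \<le> \<sigma>"
  shows "0 \<le> xi_min y" "xi_min y \<le> \<rho>"
proof -
  have "(\<sigma> - y) * s \<le> \<sigma> * s" using assms s_nonneg by (intro mult_right_mono) auto
  then show "0 \<le> xi_min y" "xi_min y \<le> \<rho>"
    using assms s_nonneg rho_eq tau_nonneg by (auto simp: xi_min_def)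
qed

lemma xi_min_gt:
  assumes "\<sigma> < y" "y < int p"
  shows "\<rho> < xi_min y" "xi_min y < int q"
proof -
  have "(\<sigma> + 1) * s \<le> (int p + \<sigma> - y) * s"
    using assms s_nonneg by (intro mult_right_mono) auto
  then show "\<rho> < xi_min y" using assms s_pos rho_eq by (simp add: xi_min_def algebra_simps)
  let ?k = "int p - \<sigma> - 1"
  have k: "0 \<le> ?k" "?k \<le> \<sigma>" using p_le sigma_less by auto
  have s0: "0 < \<sigma>" using tau_nonneg tau_less by simp
  \<comment> \<open>The largest coordinate occurs at \<open>y = \<sigma> + 1\<close>; the factor
    \<open>\<sigma> p\<close> allows \<open>s\<close> to be eliminated by
    \<open>sigma_s_p\<close>.\<close>
  have "\<sigma> * (((int p - 1) * s + \<tau>) * int p) = (int p - 1) * (\<sigma> * (s * int p)) + \<sigma> * \<tau> * int p"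
    by (simp add: algebra_simps)
  also have "\<dots> = (int p - 1) * (?k * int q - (int p - 1)) - ?k * \<tau> * int p"
    unfolding sigma_s_p by (simp add: algebra_simps)
  also have "\<dots> \<le> (int p - 1) * (?k * int q - (int p - 1))"
    using k tau_nonneg by simp
  also have "\<dots> < (int p - 1) * (?k * int q)"
    using p_gt_2 by simp
  also have "\<dots> \<le> int p * (\<sigma> * int q)"
    using k p_gt_2 by (intro mult_mono) auto
  finally have "\<sigma> * (((int p - 1) * s + \<tau>) * int p) < \<sigma> * (int q * int p)" by (simp add: mult_ac)
  then have "(int p - 1) * s + \<tau> < int q"
    using s0 p_gt_2 by (simp add: mult_less_cancel_left mult_less_cancel_right)
  moreover have "(int p + \<sigma> - y) * s \<le> (int p - 1) * s"
    using assms s_nonneg by (intro mult_right_mono) auto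
  ultimately show "xi_min y < int q" using assms by (simp add: xi_min_def)
qed

lemma xi_min_range:
  assumes "0 \<le> y" "y < int p"
  shows "0 \<le> xi_min y \<and> xi_min y < int q"
  using xi_min_le[of y] xi_min_gt[of y] assms rho_less rho_nonneg by (cases "y \<le> \<sigma>") auto

text \<open>For \<open>y \<le> \<sigma>\<close> the point is \<open>y + 1\<close> gaps above the
  threshold, hence outside, and stays outside. For \<open>y > \<sigma>\<close> the reduced value is
  \<open>p - 1 - y\<close> gaps below, hence outside, and the shift either overshoots the threshold
  or wraps into \<open>{0..\<sigma>}\<close>.\<close>

lemma shift_sum_min: "shift_sum ((\<rho> + s) * int p - int q) xi_min d = - (int p - \<sigma> - 1)"
proof -
  define N where "N = (\<rho> + s) * int p - int q"
  have N: "N = \<sigma> * s * int p + \<tau> * int p + s * int p - int q"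
    unfolding N_def rho_eq by (simp add: algebra_simps)
  have "of_bool (inside N (xi_min y) y) - of_bool (inside N (xi_min y) ((y + d) mod int p))
      = - (of_bool (\<sigma> < y) :: int)"
    if y: "0 \<le> y" "y < int p" for y
  proof (cases "y \<le> \<sigma>")
    case True
    have "\<not> inside N (xi_min y) y"
      using True xi_min_le[OF y(1) True] mult_gap_pos[of "y + 1"] y
      by (simp add: inside_def xi_min_def N algebra_simps)
    then have "\<not> inside N (xi_min y) ((y + d) mod int p)"
      using inside_loss_imp_gt[OF y, of d] True d_pos d_le by fastforce
    with \<open>\<not> inside N (xi_min y) y\<close> show ?thesis using True by simp
  next
    case False
    define j where "j = int p - 1 - y"
    have j: "0 \<le> j" "j \<le> \<sigma>" using False y p_le by (auto simp: j_def)
    have yj: "y = int p - 1 - j" by (simp add: j_def)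
    have "\<not> inside N (xi_min y) y"
      using False xi_min_gt[of y] mult_gap_nonneg[OF j(1)] y
      unfolding yj by (simp add: inside_def xi_min_def N algebra_simps)
    moreover have "inside N (xi_min y) ((y + d) mod int p)"
    proof (cases "y + d < int p")
      case True
      then have "(y + d) mod int p = y + d" using y d_pos by simp
      moreover have "inside N (xi_min y) (y + d)"
        using False xi_min_gt[of y] mult_gap_less[OF j] y
        unfolding yj by (simp add: inside_def xi_min_def N algebra_simps)
      ultimately show ?thesis by simp
    next
      case wrap: False
      then have "(y + d) mod int p \<le> \<sigma>"
        using y d_pos d_le p_le by (subst mod_p_shift) auto
      then show ?thesis using False xi_min_gt[of y] y by (simp add: inside_def)
    qed
    ultimately show ?thesis using False by simp
  qed
  then have "shift_sum N xi_min d = (\<Sum>y\<in>{0..<int p}. - of_bool (\<sigma> < y))"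
    unfolding shift_sum_def by (intro sum.cong) auto
  then show ?thesis using sum_of_bool_gt_sigma by (simp add: sum_negf N_def)
qed

section \<open>The extremal coefficients\<close>

lemma tcoeff_max:
  assumes "[int r * g = - 1] (mod (int p * int q))"
    and "t = \<lfloor>real_of_int ((\<sigma> * int q - u) * int r) / (real p * real q)\<rfloor> + 1"
    and "\<And>y. 0 \<le> y \<Longrightarrow> y < int p \<Longrightarrow> 0 \<le> \<mu> y \<and> \<mu> y < int p"
    and point: "\<And>y. (\<sigma> - y) * s * int p + y * int q = u + \<mu> y * g"
  shows "tcoeff (int r * u + t * int p * int q) = \<sigma> + 1"
proof -
  have "[xi_max y * int p + y * int q = u + \<mu> y * g] (mod (int p * int q))" for y
    unfolding point[symmetric] by (auto simp: xi_max_def cong_iff_dvd_diff algebra_simps)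
  then have "tcoeff (int r * u + t * int p * int q) = shift_sum (\<sigma> * int q) xi_max d"
    using assms xi_max_range by (intro tcoeff_eq_threshold_shift_sum[where \<mu> = \<mu> and g = g]) auto
  then show ?thesis using shift_sum_max by simp
qed

text \<open>Two identities arise because the progression passes from \<open>y = p - 1\<close> to
  \<open>y = 0\<close> cyclically; replacing \<open>y\<close> by \<open>y - p\<close> changes the
  value by \<open>p q\<close> only.\<close>

lemma tcoeff_min:
  assumes "[int r * g = - 1] (mod (int p * int q))"
    and "t = \<lfloor>real_of_int (((\<rho> + s) * int p - int q - u) * int r) / (real p * real q)\<rfloor> + 1"
    and "\<And>y. 0 \<le> y \<Longrightarrow> y < int p \<Longrightarrow> 0 \<le> \<mu> y \<and> \<mu> y < int p"
    and "\<And>y. y \<le> \<sigma> \<Longrightarrow> ((\<sigma> - y) * s + \<tau>) * int p + y * int q = u + \<mu> y * g"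
    and "\<And>y. \<sigma> < y \<Longrightarrow>
      ((int p + \<sigma> - y) * s + \<tau>) * int p + (y - int p) * int q = u + \<mu> y * g"
  shows "tcoeff (int r * u + t * int p * int q) = - (int p - \<sigma> - 1)"
proof -
  have "xi_min y * int p + y * int q - (u + \<mu> y * g) = (if y \<le> \<sigma> then 0 else int p * int q)" for y
    using assms(4,5)[of y] by (simp add: xi_min_def algebra_simps)
  then have "[xi_min y * int p + y * int q = u + \<mu> y * g] (mod (int p * int q))" for y
    by (simp add: cong_iff_dvd_diff)
  then have "tcoeff (int r * u + t * int p * int q) = shift_sum ((\<rho> + s) * int p - int q) xi_min d"
    using assms(1-3) xi_min_range by (intro tcoeff_eq_threshold_shift_sum[where \<mu> = \<mu> and g = g]) auto
  then show ?thesis using shift_sum_min by simp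
qed

lemma coeff_set_eq:
  assumes "tcoeff km = - (int p - \<sigma> - 1)" "tcoeff kp = \<sigma> + 1"
  shows "{cyclotomic_coeff (p * q * r) k | k. k \<ge> 0}
       = {of_int z | z. - (int p - \<sigma> - 1) \<le> z \<and> z \<le> \<sigma> + 1}"
  using assms tcoeff_range[OF _ _ d_le d_cong] d_pos d_le p_le sigma_nonneg
  by (intro coeff_set_eq_interval) auto

end

section \<open>The value of M(p;q) and the theorem\<close>

lemma ternary_max_height_eq:
  assumes tern: "\<And>r. prime r \<Longrightarrow> q < r \<Longrightarrow> ternary p q r \<rho> \<sigma>"
    and p_le: "int p \<le> 2 * (\<sigma> + 1)"
    and r: "prime r" "q < r" "ternary.tcoeff p q r \<rho> \<sigma> k = \<sigma> + 1"
  shows "ternary_max_height p q = real_of_int (\<sigma> + 1)"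
proof -
  let ?H = "{cyclotomic_height (p * q * r) | r. prime r \<and> r > q}"
  interpret r: ternary p q r \<rho> \<sigma> using r by (intro tern)
  have H: "?H \<subseteq> real_of_int ` {0..\<sigma> + 1}"
    using ternary.cyclotomic_height_le(1)[OF tern] ternary.abs_tcoeff_le[OF tern p_le] by blast
  then have "finite ?H" by (rule finite_subset) simp
  moreover have "real_of_int (\<sigma> + 1) \<in> ?H"
    using r.cyclotomic_height_le(2)[OF r.abs_tcoeff_le[OF p_le] r(3)] r.sigma_nonneg r(1,2)
    by (intro CollectI exI[of _ r]) simp
  ultimately show ?thesis
    unfolding ternary_max_height_def using H by (intro Max_eqI) auto
qed

text \<open>Cancelling \<open>q\<close> gives \<open>2 \<sigma> - l = p c\<close>. Here
  \<open>c\<close> is odd by parity, and the size bounds leave only \<open>c = 1\<close>.\<close>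

lemma cong_prime_half_inverse:
  fixes \<sigma> l :: int and p q :: nat
  assumes "prime p" "odd p" "odd l" "[(l + 2) * int q = 2] (mod int p)" "[(\<sigma> + 1) * int q = 1] (mod int p)"
    and "0 \<le> \<sigma>" "\<sigma> + 1 < int p" "0 \<le> l" "l + 2 < int p"
  shows "2 * \<sigma> = int p + l"
proof -
  have "[2 * (\<sigma> + 1) * int q = 2] (mod int p)"
    using cong_mult[OF cong_refl[of 2] assms(5)] by (simp only: mult.assoc mult_1_right)
  then have "[2 * (\<sigma> + 1) * int q = (l + 2) * int q] (mod int p)"
    using assms(4) by (blast intro: cong_trans cong_sym)
  moreover have "coprime (int q) (int p)"
  proof -
    have "coprime ((\<sigma> + 1) * int q) (int p)"
      using cong_imp_coprime[OF cong_sym[OF assms(5)]] by simp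
    then show ?thesis by simp
  qed
  ultimately have "[2 * (\<sigma> + 1) = l + 2] (mod int p)"
    by (simp add: cong_mult_rcancel)
  then obtain c where c: "2 * \<sigma> - l = int p * c"
    by (auto simp: cong_iff_dvd_diff dvd_def)
  have "odd (int p * c)" unfolding c[symmetric] using \<open>odd l\<close> by simp
  then have "odd c" by simp
  have "int p * c < int p * 2" "int p * (- 1) < int p * c"
    unfolding c[symmetric] using assms by auto
  moreover have "0 < int p" using assms(7) \<open>0 \<le> \<sigma>\<close> by linarith
  ultimately have "c < 2" "- 1 < c" by (simp_all only: mult_less_cancel_left_pos)
  then have "c = 1" using \<open>odd c\<close> by (cases "c = 0") auto
  then show ?thesis using c by simp
qed

theorem theorem2:
  fixes l \<rho> \<sigma> s \<tau> w :: int
    and p q r\<^sub>1 r\<^sub>2 :: nat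
    and \<alpha>p \<alpha>m u1p u1m u2p u2m t1p t1m t2p t2m k1p k1m k2p k2m :: int
  assumes "l \<ge> 1" and "odd l"
    and "prime p" and "prime q" and "2 < p" and "p < q"
    and "real q \<ge> (real p + real_of_int l) * real p / 2"
    and "[(l + 2) * int q = 2] (mod int p)"
    and "\<rho> \<ge> 0" and "\<sigma> \<ge> 0"
    and "1 + int p * int q = (\<rho> + 1) * int p + (\<sigma> + 1) * int q"
    and "s \<ge> 0" and "0 \<le> \<tau>" and "\<tau> < (int p + l) div 2"
    and "\<rho> = (int p + l) div 2 * s + \<tau>"
    and "prime r\<^sub>1" and "r\<^sub>1 > p * q"
    and "prime r\<^sub>2" and "r\<^sub>2 > p * q"
    and "[int r\<^sub>1 * (int q - s * int p) = - 1] (mod (int p * int q))"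
    and "[int r\<^sub>2 = - int r\<^sub>1] (mod (int p * int q))"
    and "0 \<le> w" and "w \<le> int p - 1" and "[w * (l + 2) = 2] (mod int p)"
  defines "\<alpha>p \<equiv> (int p + l) div 2 * int q"
    and "\<alpha>m \<equiv> (\<rho> + s) * int p - int q"
    and "u1p \<equiv> (\<rho> - \<tau>) * int p"
    and "u1m \<equiv> - ((int p - l - 2) div 2 * int q) + ((int p - 1) * s + \<tau>) * int p"
    and "u2p \<equiv> (int p - 1) * int q - (int p - l - 2) div 2 * s * int p"
    and "u2m \<equiv> (int p + l) div 2 * int q + \<tau> * int p"
    and "t1p \<equiv> \<lfloor>real_of_int ((\<alpha>p - u1p) * int r\<^sub>1) / (real p * real q)\<rfloor> + 1"
    and "t1m \<equiv> \<lfloor>real_of_int ((\<alpha>m - u1m) * int r\<^sub>1) / (real p * real q)\<rfloor> + 1"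
    and "t2p \<equiv> \<lfloor>real_of_int ((\<alpha>p - u2p) * int r\<^sub>2) / (real p * real q)\<rfloor> + 1"
    and "t2m \<equiv> \<lfloor>real_of_int ((\<alpha>m - u2m) * int r\<^sub>2) / (real p * real q)\<rfloor> + 1"
    and "k1p \<equiv> int r\<^sub>1 * u1p + t1p * int p * int q"
    and "k1m \<equiv> int r\<^sub>1 * u1m + t1m * int p * int q"
    and "k2p \<equiv> int r\<^sub>2 * u2p + t2p * int p * int q"
    and "k2m \<equiv> int r\<^sub>2 * u2m + t2m * int p * int q"
  shows
    "(l + 2 \<le> w \<and> real_of_int w \<le> real_of_int (int p - l - 2) / 2 \<longrightarrow>
        cyclotomic_coeff (p * q * r\<^sub>1) k1m = - (of_int (int p - l - 2) / 2) \<and>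
        cyclotomic_coeff (p * q * r\<^sub>1) k1p = of_int (int p + l + 2) / 2 \<and>
        {cyclotomic_coeff (p * q * r\<^sub>1) k | k. k \<ge> 0} =
          {of_int z | z :: int. - (real_of_int (int p - l - 2) / 2) \<le> real_of_int z \<and>
                                real_of_int z \<le> real_of_int (int p + l + 2) / 2}) \<and>
     (real_of_int (int p + l + 2) / 2 \<le> real_of_int w \<and> w \<le> int p - l - 2 \<longrightarrow>
        cyclotomic_coeff (p * q * r\<^sub>2) k2m = - (of_int (int p - l - 2) / 2) \<and>
        cyclotomic_coeff (p * q * r\<^sub>2) k2p = of_int (int p + l + 2) / 2 \<and>
        {cyclotomic_coeff (p * q * r\<^sub>2) k | k. k \<ge> 0} =
          {of_int z | z :: int. - (real_of_int (int p - l - 2) / 2) \<le> real_of_int z \<and>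
                                real_of_int z \<le> real_of_int (int p + l + 2) / 2}) \<and>
     ((l + 2 \<le> w \<and> real_of_int w \<le> real_of_int (int p - l - 2) / 2) \<or>
      (real_of_int (int p + l + 2) / 2 \<le> real_of_int w \<and> w \<le> int p - l - 2) \<longrightarrow>
        ternary_max_height p q = real_of_int (int p + l + 2) / 2 \<and>
        real_of_int (int p + l + 2) / 2 < 2 * real p / 3)"
proof -
  let ?A = "l + 2 \<le> w \<and> real_of_int w \<le> real_of_int (int p - l - 2) / 2"
  let ?B = "real_of_int (int p + l + 2) / 2 \<le> real_of_int w \<and> w \<le> int p - l - 2"
  have A: "?A \<longleftrightarrow> l + 2 \<le> w \<and> 2 * w \<le> int p - l - 2"
    using of_int_le_iff[of "2 * w" "int p - l - 2", where ?'a = real] by auto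
  have B: "?B \<longleftrightarrow> int p + l + 2 \<le> 2 * w \<and> w \<le> int p - l - 2"
    using of_int_le_iff[of "int p + l + 2" "2 * w", where ?'a = real] by auto
  have tern: "ternary p q r \<rho> \<sigma>" if "prime r" "q < r" for r
    using assms that by unfold_locales auto
  have q1: "q < p * q" using assms(5,6) by simp
  then have r1: "q < r\<^sub>1" and r2: "q < r\<^sub>2" using assms(17,19) by linarith+
  interpret t1: ternary p q r\<^sub>1 \<rho> \<sigma> using tern r1 assms(16) by simp
  let ?M = "int p * int q"
  have odd_p: "odd p" using assms(3,5) by (simp add: prime_odd_nat)
  have main: "2 * \<sigma> = int p + l" "3 * (l + 2) < int p" if AB: "?A \<or> ?B"
  proof -
    \<comment> \<open>Either range for \<open>w\<close> is nonempty only under this bound. Equality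
      would force \<open>p = 3\<close>, against \<open>l \<ge> 1\<close>; the strict form is
      equivalent to \<open>(p + l + 2) / 2 < 2 p / 3\<close>.\<close>
    have l: "3 * (l + 2) \<le> int p" using AB unfolding A B by presburger
    moreover have "3 * (l + 2) \<noteq> int p"
    proof
      assume e: "3 * (l + 2) = int p"
      then have "int (3 * nat (l + 2)) = int p" using assms(1) by simp
      then have "p = 3 * nat (l + 2)" by linarith
      then have "3 dvd p" by simp
      then have "p = 3" using assms(3) by (metis prime_nat_iff numeral_eq_one_iff num.distinct(3))
      then show False using e assms(1) by simp
    qed
    ultimately show l': "3 * (l + 2) < int p" by simp
    have "(\<sigma> + 1) * int q - 1 = int p * (int q - \<rho> - 1)"
      using assms(11) by (simp add: algebra_simps)
    then have "[(\<sigma> + 1) * int q = 1] (mod int p)" by (simp add: cong_iff_dvd_diff)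
    then show "2 * \<sigma> = int p + l"
      using cong_prime_half_inverse[of p l q \<sigma>] assms(1,2,3,8,10) odd_p t1.sigma_less l' by simp
  qed
  \<comment> \<open>Both \<open>w\<close> and \<open>q\<close> times the unit \<open>l + 2\<close>
    give 2 modulo \<open>p\<close>.\<close>
  have w_q: "[w = int q] (mod int p)" if AB: "?A \<or> ?B"
  proof -
    have "l + 2 < int p" using main[OF AB] assms(1) by presburger
    then have "\<not> int p dvd l + 2" using assms(1) zdvd_imp_le[of "int p" "l + 2"] by auto
    then have "coprime (l + 2) (int p)"
      using assms(3) prime_imp_coprime[of "int p" "l + 2"] by (simp add: coprime_commute)
    moreover have "[w * (l + 2) = int q * (l + 2)] (mod int p)"
      using assms(8,24) by (metis cong_sym cong_trans mult.commute)
    ultimately show ?thesis by (simp add: cong_mult_rcancel)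
  qed
  \<comment> \<open>Modulo \<open>p\<close> the factor \<open>q - s p\<close> reduces to
    \<open>q\<close>, hence to \<open>w\<close>, which is therefore the shift for the first
    prime.\<close>
  have r1_w: "[w * int r\<^sub>1 = - 1] (mod int p)" if AB: "?A \<or> ?B"
  proof -
    have "[w * int r\<^sub>1 = int q * int r\<^sub>1] (mod int p)" by (intro cong_mult w_q AB cong_refl)
    also have "[int q * int r\<^sub>1 = int r\<^sub>1 * (int q - s * int p)] (mod int p)"
      by (simp add: cong_iff_dvd_diff algebra_simps)
    also have "[int r\<^sub>1 * (int q - s * int p) = - 1] (mod int p)"
      using assms(20) by (rule cong_modulus_mult)
    finally show ?thesis .
  qed
  have half: "(int p + l) div 2 = \<sigma>" "(int p - l - 2) div 2 = int p - \<sigma> - 1"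
      "int p - l - 2 = 2 * (int p - \<sigma> - 1)" "int p + l + 2 = 2 * (\<sigma> + 1)"
    if AB: "?A \<or> ?B" using main[OF AB] by auto
  have q_ge: "\<sigma> * int p \<le> int q" if AB: "?A \<or> ?B"
  proof -
    have "real_of_int (int p + l) = real_of_int (2 * \<sigma>)" unfolding main(1)[OF AB] ..
    then have "real p + real_of_int l = 2 * real_of_int \<sigma>" by simp
    then have "real_of_int (\<sigma> * int p) \<le> real_of_int (int q)" using assms(7) by simp
    then show ?thesis by (simp only: of_int_le_iff)
  qed
  have fam1: "ternary_family p q r\<^sub>1 \<rho> \<sigma> s \<tau> w" if A': ?A
  proof -
    have AB: "?A \<or> ?B" using A' by blast
    show ?thesis
      using assms(1,12-15,17) r1_w[OF AB] q_ge[OF AB] half(1)[OF AB] main[OF AB] A'[unfolded A]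
      by unfold_locales auto
  qed
  \<comment> \<open>Negating the residue of \<open>r\<close> turns the shift into
    \<open>p - w\<close>, and the range of \<open>w\<close> in (ii) is that of (i) for
    \<open>p - w\<close>.\<close>
  have fam2: "ternary_family p q r\<^sub>2 \<rho> \<sigma> s \<tau> (int p - w)" if B': ?B
  proof -
    have AB: "?A \<or> ?B" using B' by blast
    interpret ternary p q r\<^sub>2 \<rho> \<sigma> using tern r2 assms(18) by simp
    have "[(int p - w) * int r\<^sub>2 = (int p - w) * (- int r\<^sub>1)] (mod int p)"
      using assms(21) by (intro cong_mult cong_refl) (rule cong_modulus_mult)
    also have "[(int p - w) * (- int r\<^sub>1) = w * int r\<^sub>1] (mod int p)"
      by (simp add: cong_iff_dvd_diff algebra_simps)
    also have "[w * int r\<^sub>1 = - 1] (mod int p)" using r1_w B' by blast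
    finally have "[(int p - w) * int r\<^sub>2 = - 1] (mod int p)" .
    then show ?thesis
      using assms(1,12-15,19) q_ge[OF AB] half(1)[OF AB] main[OF AB] B'[unfolded B]
      by unfold_locales auto
  qed
  \<comment> \<open>The step of the progression changes sign with \<open>r\<close>, so for the
    second prime the points are met in decreasing order of \<open>y\<close>.\<close>
  have g2: "[int r\<^sub>2 * (- (int q - s * int p)) = - 1] (mod ?M)"
  proof -
    have "[int r\<^sub>2 * (- (int q - s * int p)) = - int r\<^sub>1 * (- (int q - s * int p))] (mod ?M)"
      by (intro cong_mult assms(21) cong_refl)
    also have "- int r\<^sub>1 * (- (int q - s * int p)) = int r\<^sub>1 * (int q - s * int p)"
      by (simp only: minus_mult_minus)
    also have "[int r\<^sub>1 * (int q - s * int p) = - 1] (mod ?M)" by (rule assms(20))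
    finally show ?thesis .
  qed
  have vals: "- (of_int (int p - l - 2) / 2) = (of_int (- (int p - \<sigma> - 1)) :: complex)"
      "of_int (int p + l + 2) / 2 = (of_int (\<sigma> + 1) :: complex)"
      "real_of_int (int p + l + 2) / 2 = real_of_int (\<sigma> + 1)"
      "{of_int z | z :: int. - (real_of_int (int p - l - 2) / 2) \<le> real_of_int z \<and>
          real_of_int z \<le> real_of_int (int p + l + 2) / 2}
       = {of_int z :: complex | z. - (int p - \<sigma> - 1) \<le> z \<and> z \<le> \<sigma> + 1}"
    if AB: "?A \<or> ?B"
  proof -
    have "- (real_of_int (int p - l - 2) / 2) = real_of_int (- (int p - \<sigma> - 1))"
      unfolding half(3)[OF AB] by (simp add: field_simps)
    moreover show r: "real_of_int (int p + l + 2) / 2 = real_of_int (\<sigma> + 1)"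
      unfolding half(4)[OF AB] by (simp add: field_simps)
    ultimately show "{of_int z | z :: int. - (real_of_int (int p - l - 2) / 2) \<le> real_of_int z \<and>
          real_of_int z \<le> real_of_int (int p + l + 2) / 2}
       = {of_int z :: complex | z. - (int p - \<sigma> - 1) \<le> z \<and> z \<le> \<sigma> + 1}"
      by (simp only: of_int_le_iff)
    show "- (of_int (int p - l - 2) / 2) = (of_int (- (int p - \<sigma> - 1)) :: complex)"
      unfolding half(3)[OF AB] by (simp add: field_simps)
    show "of_int (int p + l + 2) / 2 = (of_int (\<sigma> + 1) :: complex)"
      unfolding half(4)[OF AB] by (simp add: field_simps)
  qed
  have sst: "(\<rho> - \<tau>) * int p = \<sigma> * s * int p" if AB: "?A \<or> ?B"
    using assms(15) half(1)[OF AB] by simp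
  have case1: "ternary.tcoeff p q r\<^sub>1 \<rho> \<sigma> k1m = - (int p - \<sigma> - 1)"
    "ternary.tcoeff p q r\<^sub>1 \<rho> \<sigma> k1p = \<sigma> + 1" if A': ?A
  proof -
    have AB: "?A \<or> ?B" using A' by blast
    interpret f: ternary_family p q r\<^sub>1 \<rho> \<sigma> s \<tau> w using fam1 A' by blast
    have t: "t1p = \<lfloor>real_of_int ((\<sigma> * int q - u1p) * int r\<^sub>1) / (real p * real q)\<rfloor> + 1"
      unfolding t1p_def \<alpha>p_def half(1)[OF AB] ..
    have u: "u1p = \<sigma> * s * int p" unfolding u1p_def by (rule sst[OF AB])
    \<comment> \<open>\<open>u1p\<close> is the value of \<open>(\<sigma> - y) s p + y q\<close> at
      \<open>y = 0\<close>, and each step in \<open>y\<close> adds \<open>q - s p\<close>.\<close>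
    show "ternary.tcoeff p q r\<^sub>1 \<rho> \<sigma> k1p = \<sigma> + 1"
      unfolding k1p_def
      by (rule f.tcoeff_max[OF assms(20) t, where \<mu> = "\<lambda>y. y"]) (simp_all add: u algebra_simps)
    have t': "t1m = \<lfloor>real_of_int (((\<rho> + s) * int p - int q - u1m) * int r\<^sub>1) / (real p * real q)\<rfloor> + 1"
      unfolding t1m_def \<alpha>m_def ..
    have u': "u1m = - ((int p - \<sigma> - 1) * int q) + ((int p - 1) * s + \<tau>) * int p"
      unfolding u1m_def half(2)[OF AB] ..
    \<comment> \<open>\<open>u1m\<close> belongs to \<open>y = \<sigma> + 1\<close>; \<mu> counts
      the steps from there up to \<open>p - 1\<close> and on from \<open>0\<close> to
      \<open>\<sigma>\<close>.\<close>
    show "ternary.tcoeff p q r\<^sub>1 \<rho> \<sigma> k1m = - (int p - \<sigma> - 1)"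
      unfolding k1m_def
      by (rule f.tcoeff_min[OF assms(20) t',
            where \<mu> = "\<lambda>y. if y \<le> \<sigma> then y + int p - \<sigma> - 1 else y - \<sigma> - 1"])
        (use t1.sigma_less t1.sigma_nonneg in \<open>auto simp: u' algebra_simps\<close>)
  qed
  have case2: "ternary.tcoeff p q r\<^sub>2 \<rho> \<sigma> k2m = - (int p - \<sigma> - 1)"
    "ternary.tcoeff p q r\<^sub>2 \<rho> \<sigma> k2p = \<sigma> + 1" if B': ?B
  proof -
    have AB: "?A \<or> ?B" using B' by blast
    interpret f: ternary_family p q r\<^sub>2 \<rho> \<sigma> s \<tau> "int p - w" using fam2 B' by blast
    have t: "t2p = \<lfloor>real_of_int ((\<sigma> * int q - u2p) * int r\<^sub>2) / (real p * real q)\<rfloor> + 1"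
      unfolding t2p_def \<alpha>p_def half(1)[OF AB] ..
    have u: "u2p = (int p - 1) * int q - (int p - \<sigma> - 1) * s * int p"
      unfolding u2p_def half(2)[OF AB] ..
    \<comment> \<open>\<open>u2p\<close> belongs to \<open>y = p - 1\<close>, from which \<mu>
      counts downwards.\<close>
    show "ternary.tcoeff p q r\<^sub>2 \<rho> \<sigma> k2p = \<sigma> + 1"
      unfolding k2p_def
      by (rule f.tcoeff_max[OF g2 t, where \<mu> = "\<lambda>y. int p - 1 - y"]) (simp_all add: u algebra_simps)
    have t': "t2m = \<lfloor>real_of_int (((\<rho> + s) * int p - int q - u2m) * int r\<^sub>2) / (real p * real q)\<rfloor> + 1"
      unfolding t2m_def \<alpha>m_def ..
    have u': "u2m = \<sigma> * int q + \<tau> * int p" unfolding u2m_def half(1)[OF AB] ..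
    \<comment> \<open>\<open>u2m\<close> belongs to \<open>y = \<sigma>\<close>; \<mu> counts down
      to \<open>0\<close> and on from \<open>p - 1\<close> to \<open>\<sigma> + 1\<close>.\<close>
    show "ternary.tcoeff p q r\<^sub>2 \<rho> \<sigma> k2m = - (int p - \<sigma> - 1)"
      unfolding k2m_def
      by (rule f.tcoeff_min[OF g2 t', where \<mu> = "\<lambda>y. if y \<le> \<sigma> then \<sigma> - y else \<sigma> - y + int p"])
        (use t1.sigma_less t1.sigma_nonneg in \<open>auto simp: u' algebra_simps\<close>)
  qed
  have "ternary_max_height p q = real_of_int (int p + l + 2) / 2 \<and>
      real_of_int (int p + l + 2) / 2 < 2 * real p / 3" if AB: "?A \<or> ?B"
  proof
    have "int p \<le> 2 * (\<sigma> + 1)" using main[OF AB] assms(1) by presburger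
    then show "ternary_max_height p q = real_of_int (int p + l + 2) / 2"
      unfolding vals(3)[OF AB]
      using AB case1(2) case2(2) ternary_max_height_eq[OF tern] r1 r2 assms(16,18) by blast
    have "real_of_int (3 * (l + 2)) < real_of_int (int p)"
      using main[OF AB] by (simp only: of_int_less_iff)
    then show "real_of_int (int p + l + 2) / 2 < 2 * real p / 3" by simp
  qed
  moreover have "cyclotomic_coeff (p * q * r\<^sub>1) k1m = - (of_int (int p - l - 2) / 2) \<and>
        cyclotomic_coeff (p * q * r\<^sub>1) k1p = of_int (int p + l + 2) / 2 \<and>
        {cyclotomic_coeff (p * q * r\<^sub>1) k | k. k \<ge> 0} =
          {of_int z | z :: int. - (real_of_int (int p - l - 2) / 2) \<le> real_of_int z \<and>
                                real_of_int z \<le> real_of_int (int p + l + 2) / 2}" if A': ?A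
  proof -
    have AB: "?A \<or> ?B" using A' by blast
    interpret f: ternary_family p q r\<^sub>1 \<rho> \<sigma> s \<tau> w using fam1 A' by blast
    show ?thesis
      unfolding vals(4)[OF AB] f.coeff_set_eq[OF case1[OF A']]
      unfolding vals(1,2)[OF AB] t1.cyclotomic_coeff_eq_tcoeff case1[OF A'] by simp
  qed
  moreover have "cyclotomic_coeff (p * q * r\<^sub>2) k2m = - (of_int (int p - l - 2) / 2) \<and>
        cyclotomic_coeff (p * q * r\<^sub>2) k2p = of_int (int p + l + 2) / 2 \<and>
        {cyclotomic_coeff (p * q * r\<^sub>2) k | k. k \<ge> 0} =
          {of_int z | z :: int. - (real_of_int (int p - l - 2) / 2) \<le> real_of_int z \<and>
                                real_of_int z \<le> real_of_int (int p + l + 2) / 2}" if B': ?B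
  proof -
    have AB: "?A \<or> ?B" using B' by blast
    interpret f: ternary_family p q r\<^sub>2 \<rho> \<sigma> s \<tau> "int p - w" using fam2 B' by blast
    show ?thesis
      unfolding vals(4)[OF AB] f.coeff_set_eq[OF case2[OF B']]
      unfolding vals(1,2)[OF AB] f.cyclotomic_coeff_eq_tcoeff case2[OF B'] by simp
  qed
  ultimately show ?thesis by blast
qed

end
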